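(* Let $u$ be an inner function on the open unit disk with $u(0)=0$. Then the dual of the compressed shift $D_u$ on $\mathcal{K}_u^{\perp}$ is unitarily equivalent to the operator $S\oplus S^{*}$ on $H^2\oplus H^2$, where $(Sf)(z)=zf(z)$ is the unilateral shift on $H^2$ and $(S^{*}f)(z)=\frac{f(z)-f(0)}{z}$ is its adjoint.
   Context: $L^2=L^2(\mathbb{T},dm)$, where $\mathbb{T}$ is the unit circle and $m$ is normalized Lebesgue measure. $H^2$ is the Hardy space, viewed as the closed subspace $\{f\in L^2:\widehat f(n)=0\ \forall n<0\}$ of $L^2$. For an inner function $u$, the model space is $\mathcal{K}_u=H^2\cap (uH^2)^{\perp}$, $P_u$ is the orthogonal projection of $L^2$ onto $\mathcal{K}_u$, and $\mathcal{K}_u^{\perp}$ is the orthogonal complement of $\mathcal{K}_u$ in $L^2$. The dual of the compressed shift is the operator $D_u:\mathcal{K}_u^{\perp}\to\mathcal{K}_u^{\perp}$, $D_uf=(I-P_u)(zf)$. *)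

theory Defs
  imports "HOL-Complex_Analysis.Complex_Analysis"
begin

section \<open>Complex inner product spaces\<close>

text \<open>The inner product is linear in the first and conjugate-linear in the second argument.\<close>

class complex_inner = ab_group_add +
  fixes scaleC :: "complex \<Rightarrow> 'a \<Rightarrow> 'a"  (infixr "*\<^sub>C" 75)
    and cinner :: "'a \<Rightarrow> 'a \<Rightarrow> complex"
  assumes scaleC_add_right: "a *\<^sub>C (x + y) = a *\<^sub>C x + a *\<^sub>C y"
    and scaleC_add_left: "(a + b) *\<^sub>C x = a *\<^sub>C x + b *\<^sub>C x"
    and scaleC_scaleC: "a *\<^sub>C b *\<^sub>C x = (a * b) *\<^sub>C x"
    and scaleC_one: "1 *\<^sub>C x = x"
    and cinner_commute: "cinner x y = cnj (cinner y x)"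
    and cinner_add_left: "cinner (x + y) z = cinner x z + cinner y z"
    and cinner_scaleC_left: "cinner (a *\<^sub>C x) y = a * cinner x y"
    and cinner_ge_zero: "0 \<le> Re (cinner x x)"
    and cinner_eq_zero_iff: "cinner x x = 0 \<longleftrightarrow> x = 0"

instantiation prod :: (complex_inner, complex_inner) complex_inner
begin

definition "c *\<^sub>C p = (c *\<^sub>C fst p, c *\<^sub>C snd p)"

definition "cinner p q = cinner (fst p) (fst q) + cinner (snd p) (snd q)"

instance
proof
  fix x y z :: "'a \<times> 'b" and a b :: complex
  show "cinner x y = cnj (cinner y x)"
    unfolding cinner_prod_def
    by (metis cinner_commute complex_cnj_add)
  have im: "Im (cinner v v) = 0" for v :: "'c :: complex_inner"
    using arg_cong[OF cinner_commute[of v v], of Im] by simp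
  show "cinner x x = 0 \<longleftrightarrow> x = 0"
  proof
    assume "cinner x x = 0"
    then have "Re (cinner (fst x) (fst x)) + Re (cinner (snd x) (snd x)) = 0"
      unfolding cinner_prod_def by (metis plus_complex.sel(1) zero_complex.sel(1))
    then have "Re (cinner (fst x) (fst x)) = 0" "Re (cinner (snd x) (snd x)) = 0"
      using cinner_ge_zero[of "fst x"] cinner_ge_zero[of "snd x"] by linarith+
    then have "cinner (fst x) (fst x) = 0" "cinner (snd x) (snd x) = 0"
      using im by (simp_all add: complex_eq_iff)
    then show "x = 0"
      by (simp add: cinner_eq_zero_iff prod_eq_iff)
  next
    assume "x = 0"
    then show "cinner x x = 0"
      unfolding cinner_prod_def
      by (metis add.right_neutral cinner_eq_zero_iff fst_zero snd_zero)
  qed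
qed (simp_all add: scaleC_prod_def cinner_prod_def scaleC_add_right scaleC_add_left
      scaleC_scaleC scaleC_one cinner_add_left cinner_scaleC_left cinner_ge_zero
      algebra_simps)

end

definition orth_compl :: "'a::complex_inner set \<Rightarrow> 'a set" where
  "orth_compl V = {x. \<forall>y\<in>V. cinner x y = 0}"

definition orth_proj :: "'a::complex_inner set \<Rightarrow> 'a \<Rightarrow> 'a" where
  "orth_proj V x = (THE y. y \<in> V \<and> x - y \<in> orth_compl V)"

definition unitary_map ::
    "'a::complex_inner set \<Rightarrow> 'b::complex_inner set \<Rightarrow> ('a \<Rightarrow> 'b) \<Rightarrow> bool" where
  "unitary_map V W U \<longleftrightarrow>
     (\<forall>x\<in>V. \<forall>y\<in>V. U (x + y) = U x + U y) \<and>
     (\<forall>c. \<forall>x\<in>V. U (c *\<^sub>C x) = c *\<^sub>C U x) \<and>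
     (\<forall>x\<in>V. \<forall>y\<in>V. cinner (U x) (U y) = cinner x y) \<and>
     U ` V = W"

text \<open>Here \<open>A\<close> is an operator on the subspace \<open>V\<close> and \<open>B\<close> an operator on the subspace \<open>W\<close>;
  their values outside these subspaces play no role.\<close>

definition unitarily_equivalent ::
    "'a::complex_inner set \<Rightarrow> ('a \<Rightarrow> 'a) \<Rightarrow> 'b::complex_inner set \<Rightarrow> ('b \<Rightarrow> 'b) \<Rightarrow> bool" where
  "unitarily_equivalent V A W B \<longleftrightarrow>
     (\<exists>U. unitary_map V W U \<and> (\<forall>x\<in>V. U (A x) = B (U x)))"


section \<open>The space \<open>L\<^sup>2\<close> of the unit circle\<close>

definition circle_measure :: "complex measure" where
  "circle_measure =
     distr (uniform_measure lborel {0..2 * pi}) (restrict_space borel (sphere 0 1)) cis"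

definition square_integrable :: "(complex \<Rightarrow> complex) \<Rightarrow> bool" where
  "square_integrable f \<longleftrightarrow>
     f \<in> borel_measurable circle_measure \<and> integrable circle_measure (\<lambda>z. (cmod (f z))\<^sup>2)"

lemma space_circle_measure: "space circle_measure = sphere 0 1"
  by (simp add: circle_measure_def space_restrict_space)

lemma sets_circle_measure: "sets circle_measure = sets (restrict_space borel (sphere 0 1))"
  by (simp add: circle_measure_def)

lemma prob_space_circle_measure: "emeasure circle_measure (space circle_measure) = 1"
proof -
  have m: "cis \<in> uniform_measure lborel {0..2 * pi} \<rightarrow>\<^sub>M restrict_space borel (sphere 0 1)"
  proof (intro measurable_restrict_space2)
    have "cis \<in> borel_measurable borel"
      by (intro borel_measurable_continuous_onI continuous_intros)
    then show "cis \<in> borel_measurable (uniform_measure lborel {0..2 * pi})"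
      by (simp add: measurable_def)
  qed simp
  have "emeasure circle_measure (sphere 0 1) =
      emeasure (uniform_measure lborel {0..2 * pi}) UNIV"
    unfolding circle_measure_def
    by (subst emeasure_distr[OF m]) (auto simp: sets_restrict_space vimage_def)
  also have "\<dots> = 1"
    by (subst emeasure_uniform_measure) (auto simp: ennreal_divide_self)
  finally show ?thesis by (simp add: space_circle_measure)
qed

lemma finite_measure_circle_measure: "finite_measure circle_measure"
  by (rule finite_measureI) (simp add: prob_space_circle_measure)

lemma borel_measurable_circle_measure:
  "f \<in> borel_measurable borel \<Longrightarrow> f \<in> borel_measurable circle_measure"
  by (subst measurable_cong_sets[OF sets_circle_measure refl])
     (rule measurable_restrict_space1)

lemma borel_measurable_cnj [measurable (raw)]:
  "f \<in> borel_measurable M \<Longrightarrow> (\<lambda>x. cnj (f x)) \<in> borel_measurable M"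
  by (rule measurable_compose[where g = cnj])
     (auto intro!: borel_measurable_continuous_onI continuous_intros)

lemma borel_measurable_power_int: "(\<lambda>z. (z :: complex) powi n) \<in> borel_measurable borel"
  unfolding power_int_def by measurable

lemma square_integrable_mult:
  assumes "square_integrable f" "square_integrable g"
  shows "integrable circle_measure (\<lambda>z. f z * cnj (g z))"
proof (rule Bochner_Integration.integrable_bound)
  show "integrable circle_measure (\<lambda>z. (cmod (f z))\<^sup>2 + (cmod (g z))\<^sup>2)"
    using assms by (simp add: square_integrable_def)
  show "(\<lambda>z. f z * cnj (g z)) \<in> borel_measurable circle_measure"
    using assms by (auto simp: square_integrable_def intro!: borel_measurable_times borel_measurable_cnj)
  have "a * b \<le> a\<^sup>2 + b\<^sup>2" if "a \<ge> 0" "b \<ge> 0" for a b :: real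
    using sum_squares_bound[of a b] mult_nonneg_nonneg[OF that] by linarith
  then show "AE z in circle_measure. norm (f z * cnj (g z)) \<le> norm ((cmod (f z))\<^sup>2 + (cmod (g z))\<^sup>2)"
    by (intro AE_I2) (simp add: norm_mult)
qed

lemma square_integrable_add:
  assumes "square_integrable f" "square_integrable g"
  shows "square_integrable (\<lambda>z. f z + g z)"
  unfolding square_integrable_def
proof
  show "(\<lambda>z. f z + g z) \<in> borel_measurable circle_measure"
    using assms by (auto simp: square_integrable_def)
  show "integrable circle_measure (\<lambda>z. (cmod (f z + g z))\<^sup>2)"
  proof (rule Bochner_Integration.integrable_bound)
    show "integrable circle_measure (\<lambda>z. 2 * (cmod (f z))\<^sup>2 + 2 * (cmod (g z))\<^sup>2)"
      using assms by (simp add: square_integrable_def)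
    show "(\<lambda>z. (cmod (f z + g z))\<^sup>2) \<in> borel_measurable circle_measure"
      using assms by (auto simp: square_integrable_def)
    have "(cmod (a + b))\<^sup>2 \<le> 2 * (cmod a)\<^sup>2 + 2 * (cmod b)\<^sup>2" for a b
    proof -
      have "(cmod (a + b))\<^sup>2 \<le> (cmod a + cmod b)\<^sup>2"
        by (simp add: norm_triangle_ineq power_mono)
      also have "\<dots> \<le> 2 * (cmod a)\<^sup>2 + 2 * (cmod b)\<^sup>2"
        using sum_squares_bound[of "cmod a" "cmod b"] by (simp add: power2_sum)
      finally show ?thesis .
    qed
    then show "AE z in circle_measure. norm ((cmod (f z + g z))\<^sup>2)
        \<le> norm (2 * (cmod (f z))\<^sup>2 + 2 * (cmod (g z))\<^sup>2)"
      by (intro AE_I2) simp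
  qed
qed

lemma square_integrable_mult_left:
  "square_integrable f \<Longrightarrow> square_integrable (\<lambda>z. c * f z)"
  by (auto simp: square_integrable_def norm_mult power_mult_distrib)

lemma square_integrable_const: "square_integrable (\<lambda>z. c)"
  using finite_measure.integrable_const[OF finite_measure_circle_measure]
  by (auto simp: square_integrable_def)

lemma square_integrable_unimodular:
  assumes "square_integrable f" "g \<in> borel_measurable borel" "\<And>z. cmod z = 1 \<Longrightarrow> cmod (g z) = 1"
  shows "square_integrable (\<lambda>z. g z * f z)"
proof -
  have "integrable circle_measure (\<lambda>z. (cmod (g z * f z))\<^sup>2) \<longleftrightarrow>
      integrable circle_measure (\<lambda>z. (cmod (f z))\<^sup>2)"
    by (intro Bochner_Integration.integrable_cong)
       (auto simp: space_circle_measure assms(3) norm_mult)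
  then show ?thesis
    using assms borel_measurable_circle_measure[OF assms(2)]
    by (auto simp: square_integrable_def)
qed

lemma square_integrable_div_z:
  assumes "square_integrable f"
  shows "square_integrable (\<lambda>z. f z / z)"
  using square_integrable_unimodular[OF assms, of inverse]
  by (simp add: norm_inverse divide_inverse mult.commute)

text \<open>Elements are classes of square integrable functions modulo equality almost everywhere; values
  of representatives off the circle are irrelevant since the circle is the whole space of
  \<^term>\<open>circle_measure\<close>.\<close>

quotient_type L2 = "complex \<Rightarrow> complex" / partial:
  "\<lambda>f g. square_integrable f \<and> square_integrable g \<and> (AE z in circle_measure. f z = g z)"
proof (rule part_equivpI)
  show "\<exists>f. square_integrable f \<and> square_integrable f \<and> (AE z in circle_measure. f z = f z)"
    using square_integrable_const by auto
qed (auto intro!: sympI transpI)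

instantiation L2 :: complex_inner
begin

lift_definition zero_L2 :: L2 is "\<lambda>_. 0"
  by (simp add: square_integrable_const)

lift_definition plus_L2 :: "L2 \<Rightarrow> L2 \<Rightarrow> L2" is "\<lambda>f g z. f z + g z"
  by (auto simp: square_integrable_add)

lift_definition uminus_L2 :: "L2 \<Rightarrow> L2" is "\<lambda>f z. - f z"
  by (auto simp: square_integrable_def)

definition minus_L2 :: "L2 \<Rightarrow> L2 \<Rightarrow> L2" where
  "minus_L2 f g = f + - g"

lift_definition scaleC_L2 :: "complex \<Rightarrow> L2 \<Rightarrow> L2" is "\<lambda>c f z. c * f z"
  by (auto simp: square_integrable_mult_left)

lift_definition cinner_L2 :: "L2 \<Rightarrow> L2 \<Rightarrow> complex" is
  "\<lambda>f g. LINT z|circle_measure. f z * cnj (g z)"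
  by (rule integral_cong_AE) (auto simp: square_integrable_def intro!: borel_measurable_times borel_measurable_cnj)

instance
proof
  fix f g h :: L2 and a b :: complex
  show "f + g + h = f + (g + h)"
    by transfer (auto simp: square_integrable_add add.assoc)
  show "f + g = g + f"
    by transfer (auto simp: square_integrable_add add.commute)
  show "0 + f = f"
    by transfer auto
  show "- f + f = 0"
    by transfer (auto simp: square_integrable_const)
  show "f - g = f + - g"
    by (rule minus_L2_def)
  show "a *\<^sub>C (f + g) = a *\<^sub>C f + a *\<^sub>C g"
    by transfer (auto intro!: square_integrable_add square_integrable_mult_left simp: distrib_left)
  show "(a + b) *\<^sub>C f = a *\<^sub>C f + b *\<^sub>C f"
    by transfer (auto intro!: square_integrable_add square_integrable_mult_left simp: distrib_right)
  show "a *\<^sub>C b *\<^sub>C f = (a * b) *\<^sub>C f"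
    by transfer (auto intro!: square_integrable_mult_left simp: mult.assoc)
  show "1 *\<^sub>C f = f"
    by transfer auto
  show "cinner f g = cnj (cinner g f)"
    by transfer (simp add: mult.commute flip: Bochner_Integration.integral_cnj)
  show "cinner (f + g) h = cinner f h + cinner g h"
    by transfer (simp add: distrib_right square_integrable_mult)
  show "cinner (a *\<^sub>C f) g = a * cinner f g"
    by transfer (simp add: mult.assoc)
  have norm_eq: "(LINT z|circle_measure. p z * cnj (p z)) =
      of_real (LINT z|circle_measure. (cmod (p z))\<^sup>2)" for p
    by (simp add: complex_norm_square[symmetric] flip: integral_complex_of_real of_real_power)
  show "0 \<le> Re (cinner f f)"
    by transfer (simp add: norm_eq)
  show "cinner f f = 0 \<longleftrightarrow> f = 0"
  proof transfer
    fix p assume "square_integrable p \<and> square_integrable p \<and> (AE z in circle_measure. p z = p z)"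
    then have p: "square_integrable p" by simp
    then have "integrable circle_measure (\<lambda>z. (cmod (p z))\<^sup>2)"
      by (simp add: square_integrable_def)
    then show "(LINT z|circle_measure. p z * cnj (p z)) = 0 \<longleftrightarrow>
        square_integrable p \<and> square_integrable (\<lambda>_. 0) \<and> (AE z in circle_measure. p z = 0)"
      using p by (simp add: norm_eq integral_nonneg_eq_0_iff_AE square_integrable_const)
  qed
qed

end

lift_definition const_L2 :: "complex \<Rightarrow> L2" is "\<lambda>c _. c"
  by (simp add: square_integrable_const)

lift_definition mult_z :: "L2 \<Rightarrow> L2" is "\<lambda>f z. z * f z"
  using square_integrable_unimodular[where g = "\<lambda>z. z"] by auto

lift_definition div_z :: "L2 \<Rightarrow> L2" is "\<lambda>f z. f z / z"
  by (auto simp: square_integrable_div_z)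

lift_definition fourier_coeff :: "L2 \<Rightarrow> int \<Rightarrow> complex" is
  "\<lambda>f n. LINT z|circle_measure. f z * cnj (z powi n)"
  by (intro ext integral_cong_AE borel_measurable_times borel_measurable_cnj
      borel_measurable_circle_measure[OF borel_measurable_power_int])
     (auto simp: square_integrable_def)

text \<open>\<open>is_mult \<phi> h f\<close> states that \<open>f = \<phi> h\<close> in \<open>L\<^sup>2\<close>; the multiplier \<open>\<phi>\<close> need only be defined
  almost everywhere.\<close>

lift_definition is_mult :: "(complex \<Rightarrow> complex) \<Rightarrow> L2 \<Rightarrow> L2 \<Rightarrow> bool" is
  "\<lambda>\<phi> h f. AE z in circle_measure. f z = \<phi> z * h z"
proof -
  fix \<phi> f f' g g' :: "complex \<Rightarrow> complex"
  assume "square_integrable f \<and> square_integrable f' \<and> (AE z in circle_measure. f z = f' z)"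
    and "square_integrable g \<and> square_integrable g' \<and> (AE z in circle_measure. g z = g' z)"
  then have "AE z in circle_measure. f z = f' z" "AE z in circle_measure. g z = g' z"
    by auto
  then have "AE z in circle_measure. (g z = \<phi> z * f z) = (g' z = \<phi> z * f' z)"
    by eventually_elim simp
  then show "(AE z in circle_measure. g z = \<phi> z * f z) = (AE z in circle_measure. g' z = \<phi> z * f' z)"
    by (rule eventually_cong) simp
qed

section \<open>The Hardy space and model spaces\<close>

definition H2 :: "L2 set" where
  "H2 = {f. \<forall>n<0. fourier_coeff f n = 0}"

text \<open>The holomorphic function on the open unit disk with which an element of \<^term>\<open>H2\<close> is
  identified.\<close>

definition disk_ext :: "L2 \<Rightarrow> complex \<Rightarrow> complex" where
  "disk_ext f w = (\<Sum>n. fourier_coeff f (int n) * w ^ n)"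

definition shift :: "L2 \<Rightarrow> L2" where
  "shift f = mult_z f"

definition backward_shift :: "L2 \<Rightarrow> L2" where
  "backward_shift f = div_z (f - const_L2 (disk_ext f 0))"

definition has_radial_limit :: "(complex \<Rightarrow> complex) \<Rightarrow> complex \<Rightarrow> complex \<Rightarrow> bool" where
  "has_radial_limit u \<zeta> w \<longleftrightarrow> ((\<lambda>r. u (complex_of_real r * \<zeta>)) \<longlongrightarrow> w) (at_left 1)"

definition inner_function :: "(complex \<Rightarrow> complex) \<Rightarrow> bool" where
  "inner_function u \<longleftrightarrow>
     u holomorphic_on ball 0 1 \<and> bounded (u ` ball 0 1) \<and>
     (AE \<zeta> in circle_measure. \<exists>w. has_radial_limit u \<zeta> w \<and> cmod w = 1)"

definition boundary_value :: "(complex \<Rightarrow> complex) \<Rightarrow> complex \<Rightarrow> complex" where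
  "boundary_value u \<zeta> = (THE w. has_radial_limit u \<zeta> w)"

definition model_space :: "(complex \<Rightarrow> complex) \<Rightarrow> L2 set" where
  "model_space u = H2 \<inter> orth_compl {f. \<exists>h\<in>H2. is_mult (boundary_value u) h f}"

definition dual_compressed_shift :: "(complex \<Rightarrow> complex) \<Rightarrow> L2 \<Rightarrow> L2" where
  "dual_compressed_shift u f = mult_z f - orth_proj (model_space u) (mult_z f)"

lemma disk_ext_0: "disk_ext f 0 = fourier_coeff f 0"
proof -
  have "disk_ext f 0 = (\<Sum>n. if n = 0 then fourier_coeff f 0 else 0)"
    unfolding disk_ext_def by (intro suminf_cong) (auto simp: power_0_left)
  also have "\<dots> = fourier_coeff f 0"
    by (subst suminf_finite[of "{0}"]) auto
  finally show ?thesis .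
qed

lemma backward_shift_adjoint:
  assumes "f \<in> H2"
  shows "cinner (shift f) g = cinner f (backward_shift g)"
proof -
  have 1: "cinner (mult_z f) g = cinner f (div_z g)"
  proof transfer
    fix f g
    show "(LINT z|circle_measure. z * f z * cnj (g z)) = (LINT z|circle_measure. f z * cnj (g z / z))"
    proof (rule Bochner_Integration.integral_cong[OF refl])
      fix z assume "z \<in> space circle_measure"
      then have "cmod z = 1" by (simp add: space_circle_measure)
      then have "z * cnj z = 1" "z \<noteq> 0" by (auto simp: complex_norm_square[symmetric])
      then show "z * f z * cnj (g z) = f z * cnj (g z / z)"
        by (simp add: field_simps)
    qed
  qed
  have "fourier_coeff f (-1) = 0"
    using assms by (simp add: H2_def)
  then have 2: "cinner f (div_z (const_L2 c)) = 0" for c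
  proof transfer
    fix f c
    assume "(LINT z|circle_measure. f z * cnj (z powi -1)) = 0"
    moreover have "(LINT z|circle_measure. f z * cnj (c / z)) =
        (LINT z|circle_measure. cnj c * (f z * cnj (z powi -1)))"
      by (rule Bochner_Integration.integral_cong) (auto simp: field_simps)
    ultimately show "(LINT z|circle_measure. f z * cnj (c / z)) = 0"
      by simp
  qed
  have 3: "div_z g = backward_shift g + div_z (const_L2 (disk_ext g 0))"
  proof -
    have "div_z h = div_z (h - k) + div_z k" for h k
    proof -
      have *: "div_z (p + q) = div_z p + div_z q" for p q
      proof transfer
        fix p q :: "complex \<Rightarrow> complex"
        assume "square_integrable p \<and> square_integrable p \<and> (AE z in circle_measure. p z = p z)"
          "square_integrable q \<and> square_integrable q \<and> (AE z in circle_measure. q z = q z)"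
        then show "square_integrable (\<lambda>z. (p z + q z) / z) \<and> square_integrable (\<lambda>z. p z / z + q z / z) \<and>
            (AE z in circle_measure. (p z + q z) / z = p z / z + q z / z)"
          by (auto simp: square_integrable_div_z square_integrable_add add_divide_distrib)
      qed
      show ?thesis using *[of "h - k" k] by simp
    qed
    then show ?thesis unfolding backward_shift_def .
  qed
  have "cinner f (p + q) = cinner f p + cinner f q" for p q
    by (metis cinner_add_left cinner_commute complex_cnj_add)
  then show ?thesis
    by (simp add: shift_def 1 2 3)
qed

end

theory Submission
  imports Defs
begin

text \<open>
  Let \<open>\<psi>\<close> be the unimodular boundary function of \<open>u\<close>. Splitting an element of \<open>L\<^sup>2\<close> by the sign of its
  frequencies, and then the analytic part along \<open>\<psi> H\<^sup>2\<close>, shows that the complement of the model space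
  is the orthogonal sum of \<open>\<psi> H\<^sup>2\<close> and the space \<open>H\<^sup>2\<^sub>-\<close> of functions with negative frequencies only.
  Since \<open>u(0) = 0\<close>, the constants lie in the model space. Hence \<open>D\<^sub>u\<close> multiplies \<open>\<psi> h\<close> by \<open>z\<close>, and it
  multiplies \<open>g\<close> in \<open>H\<^sup>2\<^sub>-\<close> by \<open>z\<close> and then drops the constant term; the flip \<open>k(z) \<mapsto> k(1/z)/z\<close> turns
  the latter into the backward shift on \<open>H\<^sup>2\<close>. So \<open>(h, k) \<mapsto> \<psi> h + k(1/z)/z\<close> is the required unitary.
\<close>

section \<open>Complex inner product spaces\<close>

text \<open>Two facts carry the argument. The first is that \<psi> h has no frequencies n \<le> 0
  when h lies in H^2. The range n < 0 gives \<psi> H^2 \<subseteq> H^2, and n = 0 makes the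
  constants orthogonal to \<psi> H^2; only the latter uses u(0) = 0. It comes from the dilations u(r
  z): their power series may be integrated termwise over the circle, and the bound on u allows r to
  tend to 1 under the integral. The second is the orthogonal splitting by the sign of the
  frequencies. The analytic part of a function is constructed as a limit of partial Fourier sums, so
  completeness of L^2 is proved first. Identifying that limit takes uniqueness of Fourier
  coefficients, which passes from Laurent polynomials to continuous functions, closed sets and
  finally Borel sets. The formula for the unitary is explicit only from the pair of Hardy spaces to
  the complement, so the equivalence is proved in that direction and inverted at the end.\<close>

lemma cinner_add_right: "cinner x (y + z) = cinner x y + cinner x z"
  by (metis cinner_add_left cinner_commute complex_cnj_add)

lemma cinner_scaleC_right: "cinner x (a *\<^sub>C y) = cnj a * cinner x y"
  by (metis cinner_commute cinner_scaleC_left complex_cnj_mult)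

lemma cinner_zero_left [simp]: "cinner 0 x = 0"
  using cinner_add_left[of 0 0 x] by simp

lemma cinner_zero_right [simp]: "cinner x 0 = 0"
  using cinner_add_right[of x 0 0] by simp

lemma cinner_diff_left: "cinner (x - y) z = cinner x z - cinner y z"
  using cinner_add_left[of "x - y" y z] by simp

lemma cinner_diff_right: "cinner x (y - z) = cinner x y - cinner x z"
  using cinner_add_right[of x "y - z" z] by simp

lemma cinner_sum_left: "cinner (\<Sum>i\<in>A. x i) y = (\<Sum>i\<in>A. cinner (x i) y)"
  by (induction A rule: infinite_finite_induct) (auto simp: cinner_add_left)

lemma Im_cinner_self [simp]: "Im (cinner x x) = 0"
  using arg_cong[OF cinner_commute[of x x], of Im] by simp

lemma cinner_self: "cinner x x = of_real (Re (cinner x x))"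
  by (simp add: complex_eq_iff)

lemma cinner_eq_zero_commute: "cinner x y = 0 \<longleftrightarrow> cinner y x = 0"
  by (metis cinner_commute complex_cnj_zero)

text \<open>With \<open>a\<close> the squared norm of \<open>y\<close> and \<open>b\<close> the
  inner product of \<open>x\<close> and \<open>y\<close>, the vector \<open>a x - b y\<close> is
  \<open>a\<close> times the component of \<open>x\<close> orthogonal to \<open>y\<close>. Its
  squared norm is nonnegative, and scaling by \<open>a\<close> avoids a division.\<close>

lemma Cauchy_Schwarz_cinner:
  "(cmod (cinner x y))\<^sup>2 \<le> Re (cinner x x) * Re (cinner y y)"
proof (cases "y = 0")
  case False
  define a where "a = Re (cinner y y)"
  define b where "b = cinner x y"
  have a: "cinner y y = of_real a" unfolding a_def by (rule cinner_self)
  have b': "cinner y x = cnj b" unfolding b_def by (rule cinner_commute)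
  have "a \<noteq> 0" using a False cinner_eq_zero_iff[of y] by auto
  then have pos: "a > 0" using cinner_ge_zero[of y] a_def by simp
  have "cinner (of_real a *\<^sub>C x - b *\<^sub>C y) (of_real a *\<^sub>C x - b *\<^sub>C y) =
      of_real a * (of_real a * cinner x x - b * cnj b)"
    by (simp add: cinner_diff_left cinner_diff_right cinner_scaleC_left cinner_scaleC_right
        a b' b_def[symmetric] algebra_simps)
  also have "b * cnj b = of_real ((cmod b)\<^sup>2)"
    by (metis complex_norm_square of_real_power)
  finally have "Re (cinner (of_real a *\<^sub>C x - b *\<^sub>C y) (of_real a *\<^sub>C x - b *\<^sub>C y)) =
      a * (a * Re (cinner x x) - (cmod b)\<^sup>2)" by simp
  with cinner_ge_zero[of "of_real a *\<^sub>C x - b *\<^sub>C y"] 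
  have "0 \<le> a * (a * Re (cinner x x) - (cmod b)\<^sup>2)" by simp
  with pos show ?thesis
    by (simp add: zero_le_mult_iff b_def a_def mult.commute)
qed simp

text \<open>Two candidates differ by a vector of \<open>V\<close> that is orthogonal to itself. This
  evaluates \<open>orth_proj\<close> wherever the value can be exhibited.\<close>

lemma orth_proj_eqI:
  assumes "y \<in> V" "x - y \<in> orth_compl V" "\<And>a b. a \<in> V \<Longrightarrow> b \<in> V \<Longrightarrow> a - b \<in> V"
  shows "orth_proj V x = y"
  unfolding orth_proj_def
proof (rule the_equality)
  fix y' assume y': "y' \<in> V \<and> x - y' \<in> orth_compl V"
  have "cinner (x - y) (y' - y) = 0" "cinner (x - y') (y' - y) = 0"
    using assms y' by (auto simp: orth_compl_def)
  then have "cinner (y' - y) (y' - y) = 0"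
    by (simp add: cinner_diff_left)
  then show "y' = y" by (simp add: cinner_eq_zero_iff)
qed (use assms in auto)

text \<open>The inverse of \<open>U\<close> on \<open>V\<close> is the intertwiner. The closure
  conditions on \<open>V\<close> ensure that sums, multiples and values of \<open>A\<close> stay
  where \<open>inv_into V U\<close> undoes \<open>U\<close>.\<close>

lemma unitarily_equivalent_sym:
  assumes equiv: "unitarily_equivalent V A W B"
    and inv: "\<And>x. x \<in> V \<Longrightarrow> A x \<in> V"
    and add: "\<And>x y. x \<in> V \<Longrightarrow> y \<in> V \<Longrightarrow> x + y \<in> V"
    and scale: "\<And>c x. x \<in> V \<Longrightarrow> c *\<^sub>C x \<in> V"
  shows "unitarily_equivalent W B V A"
proof -
  obtain U where U: "unitary_map V W U" and UA: "\<And>x. x \<in> V \<Longrightarrow> U (A x) = B (U x)"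
    using equiv by (auto simp: unitarily_equivalent_def)
  have Uadd: "\<And>x y. x \<in> V \<Longrightarrow> y \<in> V \<Longrightarrow> U (x + y) = U x + U y"
    and Uscale: "\<And>c x. x \<in> V \<Longrightarrow> U (c *\<^sub>C x) = c *\<^sub>C U x"
    and Uinner: "\<And>x y. x \<in> V \<Longrightarrow> y \<in> V \<Longrightarrow> cinner (U x) (U y) = cinner x y"
    and Uimg: "U ` V = W"
    using U by (auto simp: unitary_map_def)
  have inj: "inj_on U V"
  proof (rule inj_onI)
    fix x y assume xy: "x \<in> V" "y \<in> V" "U x = U y"
    \<comment> \<open>Isometry yields injectivity. The norm of \<open>x - y\<close> is expanded
      first, so that \<open>U\<close> is evaluated at \<open>x\<close> and \<open>y\<close>
      only.\<close>
    have "cinner (x - y) (x - y) = cinner (U x) (U x) - cinner (U x) (U y) -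
        (cinner (U y) (U x) - cinner (U y) (U y))"
      unfolding Uinner[OF xy(1) xy(1)] Uinner[OF xy(1) xy(2)] Uinner[OF xy(2) xy(1)]
        Uinner[OF xy(2) xy(2)] by (simp add: cinner_diff_left cinner_diff_right)
    also have "\<dots> = 0" using xy by simp
    finally show "x = y" by (simp add: cinner_eq_zero_iff)
  qed
  define T where "T = inv_into V U"
  have TU: "T (U x) = x" if "x \<in> V" for x
    using inj that by (simp add: T_def)
  have "unitary_map W V T"
    unfolding unitary_map_def Uimg[symmetric]
    using TU Uinner Uadd[symmetric] Uscale[symmetric] add scale by (auto simp: image_image)
  moreover have "T (B y) = A (T y)" if "y \<in> W" for y
    using that TU UA[symmetric] inv unfolding Uimg[symmetric] by auto
  ultimately show ?thesis by (auto simp: unitarily_equivalent_def)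
qed

section \<open>Normalized arc length\<close>

lemma measurable_into_circle_measure:
  "f \<in> M \<rightarrow>\<^sub>M restrict_space borel (sphere 0 1) \<Longrightarrow> f \<in> M \<rightarrow>\<^sub>M circle_measure"
  by (subst measurable_cong_sets[OF refl sets_circle_measure])

lemma cis_measurable: "cis \<in> borel \<rightarrow>\<^sub>M restrict_space borel (sphere 0 1)"
  by (intro measurable_restrict_space2 borel_measurable_continuous_onI continuous_intros) simp

lemma cis_measurable_uniform_measure:
  "cis \<in> uniform_measure lborel A \<rightarrow>\<^sub>M restrict_space borel (sphere 0 1)"
  using cis_measurable by (simp add: measurable_def)

lemma nn_integral_circle_measure:
  assumes "f \<in> borel_measurable circle_measure"
  shows "(\<integral>\<^sup>+z. f z \<partial>circle_measure) =
    (\<integral>\<^sup>+t. f (cis t) * indicator {0..2 * pi} t \<partial>lborel) / ennreal (2 * pi)"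
proof -
  have fc: "(\<lambda>t. f (cis t)) \<in> borel_measurable lborel"
    using measurable_compose[OF measurable_into_circle_measure[OF cis_measurable] assms] by simp
  show ?thesis
    using assms unfolding circle_measure_def
    by (subst nn_integral_distr[OF cis_measurable_uniform_measure], simp)
       (subst nn_integral_uniform_measure, use fc in auto)
qed

lemma cnj_measurable_circle: "cnj \<in> circle_measure \<rightarrow>\<^sub>M circle_measure"
  by (intro measurable_into_circle_measure measurable_restrict_space2 
      borel_measurable_circle_measure borel_measurable_continuous_onI continuous_intros)
    (simp add: space_circle_measure)

text \<open>In the parameter \<open>t\<close> conjugation is the substitution of
  \<open>2 * pi - t\<close> for \<open>t\<close>, which maps \<open>{0..2 * pi}\<close> onto itself
  and preserves Lebesgue measure.\<close>

lemma distr_cnj_circle_measure: "distr circle_measure circle_measure cnj = circle_measure"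
proof (rule measure_eqI)
  fix A assume "A \<in> sets (distr circle_measure circle_measure cnj)"
  then have A: "A \<in> sets circle_measure" by simp
  have A': "cnj -` A \<inter> space circle_measure \<in> sets circle_measure"
    by (rule measurable_sets[OF cnj_measurable_circle A])
  have AM: "(indicator A :: complex \<Rightarrow> ennreal) \<in> borel_measurable circle_measure" using A by simp
  have fc: "(\<lambda>t. (indicator A (cis t) :: ennreal) * indicator {0..2 * pi} t) \<in> borel_measurable lborel"
  proof -
    have "(\<lambda>t. (indicator A (cis t) :: ennreal)) \<in> borel_measurable lborel"
      using measurable_compose[OF measurable_into_circle_measure[OF cis_measurable] AM] by simp
    then show ?thesis by measurable
  qed
  have "emeasure (distr circle_measure circle_measure cnj) A =
      (\<integral>\<^sup>+z. indicator (cnj -` A \<inter> space circle_measure) z \<partial>circle_measure)"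
    using A A' by (simp add: emeasure_distr cnj_measurable_circle)
  also have "\<dots> = (\<integral>\<^sup>+z. indicator A (cnj z) \<partial>circle_measure)"
    by (intro nn_integral_cong) (auto simp: indicator_def)
  also have "\<dots> = (\<integral>\<^sup>+t. indicator A (cnj (cis t)) * indicator {0..2 * pi} t \<partial>lborel) / ennreal (2 * pi)"
    by (intro nn_integral_circle_measure measurable_compose[OF cnj_measurable_circle]) (use A in auto)
  also have "(\<integral>\<^sup>+t. indicator A (cnj (cis t)) * indicator {0..2 * pi} t \<partial>lborel) =
      (\<integral>\<^sup>+t. indicator A (cis t) * indicator {0..2 * pi} t \<partial>lborel)"
    using nn_integral_real_affine[of "\<lambda>t. indicator A (cis t) * indicator {0..2 * pi} t" "-1" "2 * pi"] fc
    by (simp add: cis.ctr complex_cnj indicator_def cos_diff sin_diff conj_commute)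
  also have "\<dots> / ennreal (2 * pi) = emeasure circle_measure A"
    using A by (subst nn_integral_circle_measure[symmetric]) auto
  finally show "emeasure (distr circle_measure circle_measure cnj) A = emeasure circle_measure A" .
qed simp

text \<open>For \<open>n \<noteq> 0\<close> the antiderivative \<open>cis (n t) / (\<i> n)\<close>
  takes the same value at both ends of a period.\<close>

lemma integral_circle_powi: "(LINT z|circle_measure. z powi n) = (if n = 0 then 1 else 0)"
proof (cases "n = 0")
  case True
  then show ?thesis
    using prob_space_circle_measure by (simp add: measure_def)
next
  case False
  have eq: "uniform_measure lborel {0..2 * pi} =
      density lborel (\<lambda>t. ennreal (indicator {0..2 * pi} t / (2 * pi)))"
    unfolding uniform_measure_def
    by (intro arg_cong2[where f = density] ext) (auto simp: indicator_def divide_ennreal ennreal_1[symmetric] simp del: ennreal_1)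
  have c: "continuous_on UNIV (\<lambda>t. cis (of_int n * t))" by (intro continuous_intros)
  have m: "(\<lambda>z::complex. z powi n) \<in> borel_measurable (restrict_space borel (sphere 0 1))"
    by (intro measurable_restrict_space1 borel_measurable_power_int)
  have "(LINT z|circle_measure. z powi n) = (LINT t|uniform_measure lborel {0..2 * pi}. cis (of_int n * t))"
    unfolding circle_measure_def by (subst integral_distr[OF cis_measurable_uniform_measure m]) (simp add: cis_power_int)
  also have "\<dots> = (LINT t|lborel. (indicator {0..2 * pi} t / (2 * pi)) *\<^sub>R cis (of_int n * t))"
    unfolding eq
    by (intro integral_density) (auto intro!: borel_measurable_continuous_onI continuous_intros)
  also have "\<dots> = (LINT t|lborel. (1 / (2 * pi)) *\<^sub>R (indicator {0..2 * pi} t *\<^sub>R cis (of_int n * t)))"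
    by simp
  also have "\<dots> = (1 / (2 * pi)) *\<^sub>R (LINT t|lborel. indicator {0..2 * pi} t *\<^sub>R cis (of_int n * t))"
    by (rule integral_scaleR_right)
  also have "(LINT t|lborel. indicator {0..2 * pi} t *\<^sub>R cis (of_int n * t)) =
      cis (of_int n * (2 * pi)) / (\<i> * of_int n) - cis (of_int n * 0) / (\<i> * of_int n)"
  proof (rule integral_FTC_atLeastAtMost)
    fix t :: real
    have "((\<lambda>t. exp (\<i> * of_int n * of_real t) / (\<i> * of_int n)) has_vector_derivative
        exp (\<i> * of_int n * of_real t)) (at t within {0..2 * pi})"
      using False by (auto intro!: derivative_eq_intros has_vector_derivative_real_field)
    then show "((\<lambda>t. cis (of_int n * t) / (\<i> * of_int n)) has_vector_derivative
        cis (of_int n * t)) (at t within {0..2 * pi})"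
      by (simp add: cis_conv_exp mult.assoc)
  qed (auto intro!: continuous_intros)
  also have "cis (of_int n * (2 * pi)) = 1"
    using cis_multiple_2pi[of "of_int n"] by (simp add: mult_ac)
  finally show ?thesis using False by simp
qed

section \<open>Uniqueness of Fourier coefficients\<close>

lemma integrable_circle_unimodular_mult:
  fixes f g :: "complex \<Rightarrow> complex"
  assumes "integrable circle_measure g" "f \<in> borel_measurable circle_measure"
    "\<And>z. cmod z = 1 \<Longrightarrow> cmod (f z) \<le> C"
  shows "integrable circle_measure (\<lambda>z. f z * g z)"
proof (rule Bochner_Integration.integrable_bound)
  show "integrable circle_measure (\<lambda>z. C * cmod (g z))"
    using assms(1) by auto
  have "cmod (f z) * cmod (g z) \<le> C * cmod (g z)" "C \<ge> 0" if "cmod z = 1" for z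
    using assms(3)[OF that] order_trans[OF norm_ge_zero assms(3)[OF that]]
    by (auto intro: mult_right_mono)
  then show "AE z in circle_measure. norm (f z * g z) \<le> norm (C * cmod (g z))"
    by (intro AE_I2) (simp add: norm_mult abs_mult space_circle_measure)
qed (use assms in auto)

text \<open>Formulated for integrable functions and with \<open>z powi n\<close> in place of its
  conjugate. As \<open>n\<close> runs through all integers, the same coefficients are covered, and
  multiplication by a power of \<open>z\<close> merely renumbers them.\<close>

definition zero_fourier :: "(complex \<Rightarrow> complex) \<Rightarrow> bool" where
  "zero_fourier g \<longleftrightarrow>
     integrable circle_measure g \<and> (\<forall>n. (LINT z|circle_measure. z powi n * g z) = 0)"

lemma integrable_powi_mult:
  "integrable circle_measure g \<Longrightarrow> integrable circle_measure (\<lambda>z. z powi n * g z)"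
  by (rule integrable_circle_unimodular_mult[where C = 1])
     (auto simp: norm_power_int intro!: borel_measurable_circle_measure borel_measurable_power_int)

lemma zero_fourier_cong:
  assumes "zero_fourier f" "\<And>z. cmod z = 1 \<Longrightarrow> f z = g z"
  shows "zero_fourier g"
proof -
  have "integrable circle_measure f \<longleftrightarrow> integrable circle_measure g"
    using assms(2) by (intro Bochner_Integration.integrable_cong) (auto simp: space_circle_measure)
  moreover have "(LINT z|circle_measure. z powi n * f z) = (LINT z|circle_measure. z powi n * g z)" for n
    using assms(2) by (intro Bochner_Integration.integral_cong) (auto simp: space_circle_measure)
  ultimately show ?thesis using assms(1) by (simp add: zero_fourier_def)
qed

lemma zero_fourier_add:
  assumes "zero_fourier f" "zero_fourier g"
  shows "zero_fourier (\<lambda>z. f z + g z)"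
  using assms by (auto simp: zero_fourier_def distrib_left integrable_powi_mult)

lemma zero_fourier_mult_left:
  assumes "zero_fourier f"
  shows "zero_fourier (\<lambda>z. c * f z)"
  using assms by (auto simp: zero_fourier_def mult.left_commute)

lemma zero_fourier_powi_mult:
  assumes "zero_fourier f"
  shows "zero_fourier (\<lambda>z. z powi k * f z)"
proof -
  have "(LINT z|circle_measure. z powi n * (z powi k * f z)) = (LINT z|circle_measure. z powi (n + k) * f z)" for n
  proof (rule Bochner_Integration.integral_cong[OF refl])
    fix z assume "z \<in> space circle_measure"
    then have "z \<noteq> 0" by (auto simp: space_circle_measure)
    then show "z powi n * (z powi k * f z) = z powi (n + k) * f z"
      by (simp add: power_int_add)
  qed
  then show ?thesis using assms by (auto simp: zero_fourier_def integrable_powi_mult)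
qed

text \<open>On the circle a real linear form is a combination of \<open>z\<close> and \<open>1/z\<close>, so multiplying by it only
  mixes shifted Fourier coefficients.\<close>

lemma zero_fourier_real_polynomial_mult:
  assumes "real_polynomial_function p" "zero_fourier g"
  shows "zero_fourier (\<lambda>z. of_real (p z) * g z)"
  using assms
proof (induction arbitrary: g)
  case (linear p)
  \<comment> \<open>These are the coefficients of \<open>z\<close> and \<open>cnj z\<close> after
    inserting Re z = (z + cnj z)/2 and Im z = (z - cnj z)/(2i) into Re z p(1) + Im z p(i).\<close>
  define \<alpha> \<beta> where "\<alpha> = (of_real (p 1) - \<i> * of_real (p \<i>)) / 2"
    and "\<beta> = (of_real (p 1) + \<i> * of_real (p \<i>)) / 2"
  interpret p: bounded_linear p by fact
  have p: "of_real (p z) = \<alpha> * z powi 1 + \<beta> * z powi - 1" if "cmod z = 1" for z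
  proof -
    have "p z = p (Re z *\<^sub>R 1 + Im z *\<^sub>R \<i>)"
      by (rule arg_cong[where f = p]) (simp add: complex_eq_iff)
    also have "\<dots> = Re z * p 1 + Im z * p \<i>" by (simp add: p.add p.scaleR)
    finally have "of_real (p z) = \<alpha> * z + \<beta> * cnj z"
      by (simp add: \<alpha>_def \<beta>_def complex_eq_iff field_simps)
    moreover have "z * cnj z = 1" using that by (simp add: complex_norm_square[symmetric])
    then have "z powi - 1 = cnj z"
      by (simp add: power_int_minus inverse_unique)
    ultimately show ?thesis by simp
  qed
  show ?case
    by (rule zero_fourier_cong[OF zero_fourier_add[OF
            zero_fourier_mult_left[OF zero_fourier_powi_mult[OF linear(2), of 1], of \<alpha>]
            zero_fourier_mult_left[OF zero_fourier_powi_mult[OF linear(2), of "-1"], of \<beta>]]])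
       (simp add: p algebra_simps)
next
  case (const c)
  then show ?case by (rule zero_fourier_mult_left)
next
  case (add p q)
  then show ?case using zero_fourier_add[OF add.IH] by (simp add: distrib_right)
next
  case (mult p q)
  then show ?case by (simp add: mult.assoc)
qed

text \<open>By Stone-Weierstrass, real polynomials in the two coordinates approximate \<phi>
  uniformly on the circle. Their integrals against \<open>g\<close> vanish, and the error is at most
  the uniform distance times the L^1 norm of \<open>g\<close>.\<close>

lemma integral_continuous_mult_zero_fourier:
  fixes \<phi> :: "complex \<Rightarrow> real"
  assumes "continuous_on UNIV \<phi>" "zero_fourier g"
  shows "(LINT z|circle_measure. of_real (\<phi> z) * g z) = 0"
proof (rule ccontr)
  define I where "I = (LINT z|circle_measure. of_real (\<phi> z) * g z)"
  define G where "G = (LINT z|circle_measure. cmod (g z))"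
  assume "(LINT z|circle_measure. of_real (\<phi> z) * g z) \<noteq> 0"
  then have I: "cmod I > 0" by (simp add: I_def)
  have g: "integrable circle_measure g" using assms by (simp add: zero_fourier_def)
  have G: "G \<ge> 0" by (simp add: G_def)
  \<comment> \<open>The summand 1 keeps the quotient defined when \<open>G = 0\<close> and makes
    \<open>e * G\<close> strictly smaller than \<open>cmod I\<close>.\<close>
  define e where "e = cmod I / (G + 1)"
  have e: "e > 0" using I G by (simp add: e_def)
  have cont: "continuous_on (sphere 0 1) \<phi>" using assms(1) continuous_on_subset by blast
  obtain p where p: "real_polynomial_function p" "\<And>z. z \<in> sphere 0 1 \<Longrightarrow> \<bar>\<phi> z - p z\<bar> < e"
    by (rule Stone_Weierstrass_real_polynomial_function[OF compact_sphere cont e]) blast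
  have pz: "zero_fourier (\<lambda>z. of_real (p z) * g z)"
    using zero_fourier_real_polynomial_mult p(1) assms(2) by blast
  have pI: "(LINT z|circle_measure. of_real (p z) * g z) = 0"
    "integrable circle_measure (\<lambda>z. of_real (p z) * g z)"
    using pz unfolding zero_fourier_def by (auto dest: spec[of _ 0])
  have "p \<in> borel_measurable borel"
    using p(1) by (intro borel_measurable_continuous_onI continuous_on_polymonial_function)
      (simp add: real_polynomial_function_eq)
  moreover have "\<phi> \<in> borel_measurable borel"
    using assms(1) by (rule borel_measurable_continuous_onI)
  ultimately have m: "(\<lambda>z. of_real (\<phi> z - p z) :: complex) \<in> borel_measurable circle_measure"
    by (intro borel_measurable_circle_measure) measurable
  have i: "integrable circle_measure (\<lambda>z. of_real (\<phi> z - p z) * g z)"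
    using p(2) by (intro integrable_circle_unimodular_mult[where C = e] g m) (auto intro: less_imp_le simp flip: of_real_diff)
  have "I = (LINT z|circle_measure. of_real (\<phi> z - p z) * g z + of_real (p z) * g z)"
    unfolding I_def by (simp add: algebra_simps)
  also have "\<dots> = (LINT z|circle_measure. of_real (\<phi> z - p z) * g z)"
    using i pI by simp
  finally have "cmod I \<le> (LINT z|circle_measure. cmod (of_real (\<phi> z - p z) * g z))"
    by simp
  also have "\<dots> \<le> (LINT z|circle_measure. e * cmod (g z))"
  proof (rule integral_mono)
    show "integrable circle_measure (\<lambda>z. cmod (of_real (\<phi> z - p z) * g z))"
      using i by (rule integrable_norm)
    show "integrable circle_measure (\<lambda>z. e * cmod (g z))" using g by simp
    show "cmod (of_real (\<phi> z - p z) * g z) \<le> e * cmod (g z)" if "z \<in> space circle_measure" for z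
      using p(2)[of z] that
      by (auto simp: norm_mult space_circle_measure intro!: mult_right_mono simp flip: of_real_diff)
  qed
  also have "\<dots> = e * G" by (simp add: G_def)
  also have "\<dots> < cmod I" using I G by (simp add: e_def field_simps)
  finally show False by simp
qed

text \<open>The indicator of a closed set is a pointwise limit of continuous functions with values
  in [0, 1], so dominated convergence applies.\<close>

lemma set_integral_closed_zero_fourier:
  assumes "closed A" "zero_fourier g"
  shows "(LINT z|circle_measure. indicator A z *\<^sub>R g z) = 0"
\<comment> \<open>For the empty set \<open>infdist\<close> has the default value 0, and the cutoffs
  below would be constantly 1.\<close>
proof (cases "A = {}")
  case False
  have g: "integrable circle_measure g" using assms by (simp add: zero_fourier_def)
  \<comment> \<open>A cutoff equal to 1 on \<open>A\<close> and to 0 at distance at least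
    \<open>1 / k\<close> from \<open>A\<close>, for positive \<open>k\<close>.\<close>
  define \<phi> where "\<phi> k z = max 0 (1 - real k * infdist z A)" for k z
  have cont: "continuous_on UNIV (\<phi> k)" for k
    unfolding \<phi>_def by (intro continuous_intros)
  have \<phi>m: "\<phi> k \<in> borel_measurable borel" for k
    using cont by (rule borel_measurable_continuous_onI)
  have "A \<in> sets borel" using assms(1) by simp
  then have Am: "(indicator A :: complex \<Rightarrow> real) \<in> borel_measurable circle_measure"
    by (intro borel_measurable_circle_measure) simp
  have "(\<lambda>k. LINT z|circle_measure. \<phi> k z *\<^sub>R g z) \<longlonglongrightarrow>
      (LINT z|circle_measure. indicator A z *\<^sub>R g z)"
  proof (rule integral_dominated_convergence)
    show "integrable circle_measure (\<lambda>z. cmod (g z))" using g by simp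
    show "AE z in circle_measure. (\<lambda>k. \<phi> k z *\<^sub>R g z) \<longlonglongrightarrow> indicator A z *\<^sub>R g z"
    proof (intro AE_I2 tendsto_intros)
      fix z
      show "(\<lambda>k. \<phi> k z) \<longlonglongrightarrow> indicator A z"
      proof (cases "z \<in> A")
        case True
        then show ?thesis by (simp add: \<phi>_def)
      next
        case out: False
        then have d: "infdist z A > 0"
          using in_closed_iff_infdist_zero[OF assms(1) False] infdist_nonneg[of z A] by fastforce
        obtain N :: nat where N: "1 / infdist z A < real N" using reals_Archimedean2 by blast
        have "\<phi> k z = 0" if "k \<ge> N" for k
        proof -
          have "1 / infdist z A < real k" using N that by linarith
          then have "1 < real k * infdist z A" using d by (simp add: field_simps)
          then show ?thesis by (simp add: \<phi>_def)
        qed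
        then have "eventually (\<lambda>k. \<phi> k z = 0) sequentially"
          by (auto simp: eventually_sequentially)
        then show ?thesis using out by (simp add: tendsto_eventually)
      qed
    qed
    show "AE z in circle_measure. norm (\<phi> k z *\<^sub>R g z) \<le> cmod (g z)" for k
      by (intro AE_I2) (auto simp: \<phi>_def infdist_nonneg intro!: mult_left_le_one_le)
    show "(\<lambda>z. \<phi> k z *\<^sub>R g z) \<in> borel_measurable circle_measure" for k
      using g borel_measurable_circle_measure[OF \<phi>m[of k]] by (intro borel_measurable_scaleR) auto
    show "(\<lambda>z. indicator A z *\<^sub>R g z) \<in> borel_measurable circle_measure"
      using g Am by (intro borel_measurable_scaleR) auto
  qed
  moreover have "(LINT z|circle_measure. \<phi> k z *\<^sub>R g z) = 0" for k
    using integral_continuous_mult_zero_fourier[OF cont assms(2)] by (simp add: scaleR_conv_of_real)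
  ultimately show ?thesis by (simp add: LIMSEQ_const_iff)
qed simp

text \<open>The Borel sets over which \<open>g\<close> has integral zero form a Dynkin system. It
  contains the closed sets, which are stable under intersection, hence all Borel sets; an integrable
  function whose integrals over all measurable sets vanish is zero almost everywhere.\<close>

lemma zero_fourier_imp_AE_zero:
  assumes "zero_fourier g"
  shows "AE z in circle_measure. g z = 0"
proof -
  have g: "integrable circle_measure g" using assms by (simp add: zero_fourier_def)
  have sub: "B \<inter> sphere 0 1 \<in> sets circle_measure" if "B \<in> sets borel" for B
    using that by (auto simp: sets_circle_measure sets_restrict_space)
  have si: "set_integrable circle_measure A g" if "A \<in> sets circle_measure" for A
    using g that unfolding set_integrable_def by (rule integrable_mult_indicator[rotated])
  have zero: "set_lebesgue_integral circle_measure (B \<inter> sphere 0 1) g = 0" if "B \<in> sets borel" for B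
  proof -
    have closed_zero: "set_lebesgue_integral circle_measure (B \<inter> sphere 0 1) g = 0" if "closed B" for B
      using set_integral_closed_zero_fourier[OF closed_Int[OF that closed_sphere] assms]
      by (simp add: set_lebesgue_integral_def)
    have "Int_stable (Collect (closed :: complex set \<Rightarrow> bool))"
      by (auto simp: Int_stable_def)
    moreover have "Collect closed \<subseteq> Pow (UNIV :: complex set)" by simp
    moreover have "B \<in> sigma_sets UNIV (Collect closed)"
      using that by (simp add: borel_eq_closed)
    ultimately show ?thesis
    proof (induction rule: sigma_sets_induct_disjoint)
      case (basic A)
      then show ?case using closed_zero by simp
    next
      case empty
      then show ?case by (simp add: set_lebesgue_integral_def)
    next
      case (compl A)
      have A: "A \<in> sets borel" using compl by (simp add: borel_eq_closed)
      have "set_lebesgue_integral circle_measure ((A \<inter> sphere 0 1) \<union> ((UNIV - A) \<inter> sphere 0 1)) g =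
          set_lebesgue_integral circle_measure (A \<inter> sphere 0 1) g +
          set_lebesgue_integral circle_measure ((UNIV - A) \<inter> sphere 0 1) g"
        using A by (intro set_integral_Un si sub) auto
      moreover have "(A \<inter> sphere 0 1) \<union> ((UNIV - A) \<inter> sphere 0 1) = UNIV \<inter> sphere 0 1" by auto
      ultimately show ?case using compl(2) closed_zero[of UNIV] by simp
    next
      case (union A)
      have A: "A i \<in> sets borel" for i using union by (auto simp: borel_eq_closed)
      have "(\<Union>i. A i) \<inter> sphere 0 1 = (\<Union>i. A i \<inter> sphere 0 1)" by auto
      moreover have "set_lebesgue_integral circle_measure (\<Union>i. A i \<inter> sphere 0 1) g =
          (\<Sum>i. set_lebesgue_integral circle_measure (A i \<inter> sphere 0 1) g)"
      proof (rule lebesgue_integral_countable_add)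
        show "(A i \<inter> sphere 0 1) \<inter> (A j \<inter> sphere 0 1) = {}" if "i \<noteq> j" for i j
          using union(1) that by (auto simp: disjoint_family_on_def)
        show "set_integrable circle_measure (\<Union>i. A i \<inter> sphere 0 1) g"
          using A by (intro si sets.countable_UN) (auto intro: sub)
      qed (use A sub in auto)
      ultimately show ?case using union(3) by simp
    qed
  qed
  interpret finite_measure circle_measure by (rule finite_measure_circle_measure)
  have "AE z in circle_measure. g z = (\<lambda>_. 0) z"
  proof (rule density_unique_banach[OF g])
    fix A assume "A \<in> sets circle_measure"
    then obtain B where "B \<in> sets borel" "A = B \<inter> sphere 0 1"
      by (auto simp: sets_circle_measure sets_restrict_space)
    then show "set_lebesgue_integral circle_measure A g = set_lebesgue_integral circle_measure A (\<lambda>_. 0)"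
      using zero by (simp add: set_lebesgue_integral_def)
  qed auto
  then show ?thesis by simp
qed

section \<open>Completeness\<close>

lemma cinner_self_abs_L2:
  assumes "square_integrable f"
  shows "Re (cinner (abs_L2 f) (abs_L2 f)) = (LINT z|circle_measure. (cmod (f z))\<^sup>2)"
proof -
  have "cinner (abs_L2 f) (abs_L2 f) = (LINT z|circle_measure. f z * cnj (f z))"
    using assms by (simp add: cinner_L2.abs_eq)
  also have "\<dots> = of_real (LINT z|circle_measure. (cmod (f z))\<^sup>2)"
    by (simp add: complex_norm_square[symmetric] flip: integral_complex_of_real of_real_power)
  finally show ?thesis by simp
qed

lemma square_integrable_diff:
  assumes "square_integrable f" "square_integrable g"
  shows "square_integrable (\<lambda>z. f z - g z)"
  using square_integrable_add[OF assms(1) square_integrable_mult_left[OF assms(2), of "-1"]] by simp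

lemma abs_L2_diff:
  assumes "square_integrable f" "square_integrable g"
  shows "abs_L2 f - abs_L2 g = abs_L2 (\<lambda>z. f z - g z)"
proof -
  have "square_integrable (\<lambda>z. - g z)"
    using square_integrable_mult_left[OF assms(2), of "-1"] by simp
  then show ?thesis
    using assms by (simp add: minus_L2_def uminus_L2.abs_eq plus_L2.abs_eq)
qed

lemma abs_L2_cases:
  obtains f where "square_integrable f" "x = abs_L2 f"
  by (induction x rule: L2.abs_induct) auto

lemma square_integrable_imp_integrable_circle:
  assumes "square_integrable f"
  shows "integrable circle_measure f"
  using square_integrable_mult[OF assms square_integrable_const[of 1]] by simp

text \<open>The variance of \<open>cmod (f z)\<close> under a probability measure is nonnegative.
  This makes L^2 Cauchy sequences L^1 Cauchy, hence almost everywhere Cauchy along a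
  subsequence.\<close>

lemma L1_le_L2_circle:
  assumes "square_integrable f"
  shows "(LINT z|circle_measure. cmod (f z))\<^sup>2 \<le> (LINT z|circle_measure. (cmod (f z))\<^sup>2)"
proof -
  interpret finite_measure circle_measure by (rule finite_measure_circle_measure)
  have total: "measure circle_measure (space circle_measure) = 1"
    using prob_space_circle_measure by (simp add: measure_def)
  define a where "a = (LINT z|circle_measure. cmod (f z))"
  have i: "integrable circle_measure (\<lambda>z. cmod (f z))" "integrable circle_measure (\<lambda>z. (cmod (f z))\<^sup>2)"
    using square_integrable_imp_integrable_circle[OF assms] assms by (auto simp: square_integrable_def)
  have "0 \<le> (LINT z|circle_measure. (cmod (f z) - a)\<^sup>2)" by simp
  also have "\<dots> = (LINT z|circle_measure. (cmod (f z))\<^sup>2 - 2 * a * cmod (f z) + a\<^sup>2)"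
    by (simp add: power2_diff algebra_simps)
  also have "\<dots> = (LINT z|circle_measure. (cmod (f z))\<^sup>2) - a\<^sup>2"
    using i by (simp add: total a_def power2_eq_square)
  finally show ?thesis by (simp add: a_def)
qed

text \<open>Riesz-Fischer: a subsequence converges almost everywhere, and Fatou's lemma bounds the
  distance from each late member to the pointwise limit. Convergence is phrased with squared norms
  because \<open>complex_inner\<close> carries no metric.\<close>

theorem L2_complete:
  fixes x :: "nat \<Rightarrow> L2"
  assumes "\<And>e. e > 0 \<Longrightarrow> \<exists>N. \<forall>i\<ge>N. \<forall>j\<ge>N. Re (cinner (x i - x j) (x i - x j)) < e"
  obtains y where "(\<lambda>n. Re (cinner (x n - y) (x n - y))) \<longlonglongrightarrow> 0"
proof -
  have "\<forall>n. \<exists>f. square_integrable f \<and> x n = abs_L2 f" by (metis abs_L2_cases)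
  then obtain s where s: "\<And>n. square_integrable (s n)" and x: "\<And>n. x n = abs_L2 (s n)" by metis
  have cauchy: "\<exists>N. \<forall>i\<ge>N. \<forall>j\<ge>N. (LINT z|circle_measure. (cmod (s i z - s j z))\<^sup>2) < e" if "e > 0" for e
    using assms[OF that] s by (simp add: x abs_L2_diff cinner_self_abs_L2 square_integrable_diff)
  have sm [measurable]: "s n \<in> borel_measurable circle_measure" for n
    using s by (simp add: square_integrable_def)
  obtain r where r: "strict_mono r" "AE z in circle_measure. Cauchy (\<lambda>i. s (r i) z)"
  proof (rule cauchy_L1_AE_cauchy_subseq[of circle_measure s])
    fix e :: real assume "e > 0"
    then obtain N where N: "\<forall>i\<ge>N. \<forall>j\<ge>N. (LINT z|circle_measure. (cmod (s i z - s j z))\<^sup>2) < e\<^sup>2"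
      using cauchy[of "e\<^sup>2"] by auto
    have "(LINT z|circle_measure. cmod (s i z - s j z)) < e" if "i \<ge> N" "j \<ge> N" for i j
    proof -
      have "(LINT z|circle_measure. cmod (s i z - s j z))\<^sup>2 < e\<^sup>2"
        using L1_le_L2_circle[OF square_integrable_diff[OF s s]] N that by (meson order_le_less_trans)
      then show ?thesis using \<open>e > 0\<close> by (simp add: power_less_imp_less_base)
    qed
    then show "\<exists>N. \<forall>i\<ge>N. \<forall>j\<ge>N. (LINT z|circle_measure. cmod (s i z - s j z)) < e" by blast
  qed (use s square_integrable_imp_integrable_circle in auto)
  \<comment> \<open>Where the subsequence diverges, \<open>lim\<close> has an unspecified value, but
    that happens on a null set and measurability survives.\<close>
  define g where "g z = lim (\<lambda>i. s (r i) z)" for z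
  have gm [measurable]: "g \<in> borel_measurable circle_measure"
    unfolding g_def by measurable
  have lim: "AE z in circle_measure. (\<lambda>i. s (r i) z) \<longlonglongrightarrow> g z"
    using r(2) by eventually_elim (simp add: g_def Cauchy_convergent_iff convergent_LIMSEQ_iff)
  have nn: "(\<integral>\<^sup>+z. ennreal ((cmod (s n z - s m z))\<^sup>2) \<partial>circle_measure) =
      ennreal (LINT z|circle_measure. (cmod (s n z - s m z))\<^sup>2)" for n m
    using square_integrable_diff[OF s s, of n m]
    by (intro nn_integral_eq_integral) (auto simp: square_integrable_def)
  \<comment> \<open>Only the second index runs along the subsequence; \<open>n\<close> is fixed and
    arbitrary, so the bound reaches the whole sequence.\<close>
  have fatou: "(\<integral>\<^sup>+z. ennreal ((cmod (s n z - g z))\<^sup>2) \<partial>circle_measure) \<le> ennreal e"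
    if bound: "\<And>j. j \<ge> N \<Longrightarrow> (LINT z|circle_measure. (cmod (s n z - s j z))\<^sup>2) \<le> e" for n N e
  proof -
    have "(\<integral>\<^sup>+z. ennreal ((cmod (s n z - g z))\<^sup>2) \<partial>circle_measure) =
        (\<integral>\<^sup>+z. liminf (\<lambda>i. ennreal ((cmod (s n z - s (r i) z))\<^sup>2)) \<partial>circle_measure)"
    proof (rule nn_integral_cong_AE)
      show "AE z in circle_measure. ennreal ((cmod (s n z - g z))\<^sup>2) =
          liminf (\<lambda>i. ennreal ((cmod (s n z - s (r i) z))\<^sup>2))"
        using lim
      proof eventually_elim
        case (elim z)
        have "(\<lambda>i. ennreal ((cmod (s n z - s (r i) z))\<^sup>2)) \<longlonglongrightarrow> ennreal ((cmod (s n z - g z))\<^sup>2)"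
          by (intro tendsto_intros elim)
        then show ?case by (metis lim_imp_Liminf sequentially_bot)
      qed
    qed
    also have "\<dots> \<le> liminf (\<lambda>i. \<integral>\<^sup>+z. ennreal ((cmod (s n z - s (r i) z))\<^sup>2) \<partial>circle_measure)"
      by (rule nn_integral_liminf) measurable
    also have "\<dots> \<le> ennreal e"
    proof (rule Liminf_le)
      have "ennreal (LINT z|circle_measure. (cmod (s n z - s (r i) z))\<^sup>2) \<le> ennreal e" if "i \<ge> N" for i
        using bound[of "r i"] seq_suble[OF r(1), of i] that by (intro ennreal_leI) simp
      then show "\<forall>\<^sub>F i in sequentially. (\<integral>\<^sup>+z. ennreal ((cmod (s n z - s (r i) z))\<^sup>2) \<partial>circle_measure) \<le> ennreal e"
        unfolding nn eventually_sequentially by blast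
    qed simp
    finally show ?thesis .
  qed
  have sq: "square_integrable (\<lambda>z. s n z - g z)" "(LINT z|circle_measure. (cmod (s n z - g z))\<^sup>2) \<le> e"
    if bound: "\<And>j. j \<ge> N \<Longrightarrow> (LINT z|circle_measure. (cmod (s n z - s j z))\<^sup>2) \<le> e" and "e \<ge> 0" for n N e
  proof -
    have "integrable circle_measure (\<lambda>z. (cmod (s n z - g z))\<^sup>2)"
      using order_le_less_trans[OF fatou[OF bound] ennreal_less_top] by (intro integrableI_bounded) auto
    then show "square_integrable (\<lambda>z. s n z - g z)"
      by (simp add: square_integrable_def)
    show "(LINT z|circle_measure. (cmod (s n z - g z))\<^sup>2) \<le> e"
      using fatou[OF bound] \<open>e \<ge> 0\<close> by (subst integral_eq_nn_integral) (auto simp: enn2real_leI)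
  qed
  \<comment> \<open>One finite bound on a tail already puts \<open>s N - g\<close> into L^2, and
    with it \<open>g\<close>.\<close>
  obtain N where "\<forall>i\<ge>N. \<forall>j\<ge>N. (LINT z|circle_measure. (cmod (s i z - s j z))\<^sup>2) < 1"
    using cauchy[of 1] by auto
  then have "square_integrable (\<lambda>z. s N z - g z)"
    by (intro sq(1)[of N _ 1]) (auto intro: less_imp_le)
  from square_integrable_diff[OF s[of N] this] have g: "square_integrable g" by simp
  have "(\<lambda>n. Re (cinner (x n - abs_L2 g) (x n - abs_L2 g))) \<longlonglongrightarrow> 0"
  proof (rule LIMSEQ_I)
    fix e :: real assume "e > 0"
    \<comment> \<open>Half of \<open>e\<close>, because Fatou's lemma returns a weak
      inequality.\<close>
    then obtain N where N: "\<forall>i\<ge>N. \<forall>j\<ge>N. (LINT z|circle_measure. (cmod (s i z - s j z))\<^sup>2) < e / 2"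
      using cauchy[of "e / 2"] by auto
    have "norm (Re (cinner (x n - abs_L2 g) (x n - abs_L2 g)) - 0) < e" if "n \<ge> N" for n
    proof -
      have "(LINT z|circle_measure. (cmod (s n z - g z))\<^sup>2) \<le> e / 2"
        using N that \<open>e > 0\<close> by (intro sq(2)[of N]) (auto intro: less_imp_le)
      then show ?thesis
        using s g \<open>e > 0\<close> cinner_ge_zero by (simp add: x abs_L2_diff cinner_self_abs_L2 square_integrable_diff)
    qed
    then show "\<exists>N. \<forall>n\<ge>N. norm (Re (cinner (x n - abs_L2 g) (x n - abs_L2 g)) - 0) < e" by blast
  qed
  then show ?thesis by (rule that)
qed

section \<open>Analytic parts\<close>

lemma cnj_powi_circle:
  assumes "cmod z = 1"
  shows "cnj (z powi n) = z powi (- n)"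
proof -
  have "z * cnj z = 1" using assms by (simp add: complex_norm_square[symmetric])
  then have "cnj z = inverse z" by (simp add: inverse_unique)
  then show ?thesis by (simp add: power_int_inverse power_int_minus)
qed

lemma powi_add_circle: "cmod z = 1 \<Longrightarrow> z powi (m + n) = z powi m * z powi n"
  by (subst power_int_add) auto

section \<open>Fourier coefficients as inner products with monomials\<close>

lift_definition monomial :: "int \<Rightarrow> L2" is "\<lambda>n z. z powi n"
proof -
  fix n :: int
  have "square_integrable (\<lambda>z. z powi n)"
    using square_integrable_unimodular[OF square_integrable_const[of 1] borel_measurable_power_int, of n]
    by (simp add: norm_power_int)
  then show "square_integrable (\<lambda>z. z powi n) \<and> square_integrable (\<lambda>z. z powi n) \<and>
      (AE z in circle_measure. z powi n = z powi n)" by simp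
qed

lemma fourier_coeff_eq_cinner: "fourier_coeff f n = cinner f (monomial n)"
  by transfer simp

lemma cinner_monomial_left: "cinner (monomial n) f = cnj (fourier_coeff f n)"
  unfolding fourier_coeff_eq_cinner by (rule cinner_commute)

lemma cinner_monomial: "cinner (monomial m) (monomial n) = (if m = n then 1 else 0)"
proof -
  have "cinner (monomial m) (monomial n) = (LINT z|circle_measure. z powi (m - n))"
  proof transfer
    fix m n :: int
    show "(LINT z|circle_measure. z powi m * cnj (z powi n)) = (LINT z|circle_measure. z powi (m - n))"
    proof (rule Bochner_Integration.integral_cong[OF refl])
      fix z assume "z \<in> space circle_measure"
      then have "cmod z = 1" by (simp add: space_circle_measure)
      then show "z powi m * cnj (z powi n) = z powi (m - n)"
        by (simp only: cnj_powi_circle powi_add_circle[symmetric] diff_conv_add_uminus)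
    qed
  qed
  then show ?thesis by (simp add: integral_circle_powi)
qed

lemma fourier_coeff_add: "fourier_coeff (f + g) n = fourier_coeff f n + fourier_coeff g n"
  and fourier_coeff_diff: "fourier_coeff (f - g) n = fourier_coeff f n - fourier_coeff g n"
  and fourier_coeff_scaleC: "fourier_coeff (c *\<^sub>C f) n = c * fourier_coeff f n"
  and fourier_coeff_monomial: "fourier_coeff (monomial m) n = (if m = n then 1 else 0)"
  by (simp_all add: fourier_coeff_eq_cinner cinner_add_left cinner_diff_left cinner_scaleC_left
      cinner_monomial)

lemma mult_cnj_cmod: "z * cnj z = complex_of_real ((cmod z)\<^sup>2)"
  by (rule complex_norm_square[symmetric])

text \<open>On the circle \<open>z powi n\<close> is the conjugate of \<open>z powi (- n)\<close>,
  so a representative satisfies \<open>zero_fourier\<close>.\<close>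

lemma fourier_coeff_eq_zero_imp_zero:
  assumes "\<And>n. fourier_coeff f n = 0"
  shows "f = 0"
proof -
  have "\<forall>n. fourier_coeff f n = 0" using assms by simp
  then show ?thesis
  proof transfer
    fix f assume "square_integrable f \<and> square_integrable f \<and> (AE z in circle_measure. f z = f z)"
      and zero: "\<forall>n. (LINT z|circle_measure. f z * cnj (z powi n)) = 0"
    then have f: "square_integrable f" by simp
    have "(LINT z|circle_measure. z powi n * f z) = (LINT z|circle_measure. f z * cnj (z powi (- n)))" for n
    proof (rule Bochner_Integration.integral_cong[OF refl])
      fix z assume "z \<in> space circle_measure"
      then have "cmod z = 1" by (simp add: space_circle_measure)
      then show "z powi n * f z = f z * cnj (z powi (- n))"
        by (simp only: cnj_powi_circle minus_minus mult.commute)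
    qed
    then have "zero_fourier f"
      using zero square_integrable_imp_integrable_circle[OF f] by (simp add: zero_fourier_def)
    then show "square_integrable f \<and> square_integrable (\<lambda>_. 0) \<and> (AE z in circle_measure. f z = 0)"
      using f zero_fourier_imp_AE_zero by (simp add: square_integrable_const)
  qed
qed

lemma L2_eqI:
  assumes "\<And>n. fourier_coeff f n = fourier_coeff g n"
  shows "f = g"
  using fourier_coeff_eq_zero_imp_zero[of "f - g"] assms by (simp add: fourier_coeff_diff)

section \<open>Partial Fourier sums over nonnegative frequencies\<close>

definition analytic_sum :: "L2 \<Rightarrow> nat \<Rightarrow> L2" where
  "analytic_sum f n = (\<Sum>k<n. fourier_coeff f (int k) *\<^sub>C monomial (int k))"

lemma cinner_analytic_sum:
  "cinner (analytic_sum f n) y = (\<Sum>k<n. fourier_coeff f (int k) * cnj (fourier_coeff y (int k)))"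
  by (simp add: analytic_sum_def cinner_sum_left cinner_scaleC_left cinner_monomial_left)

lemma fourier_coeff_analytic_sum:
  "fourier_coeff (analytic_sum f n) m = (if 0 \<le> m \<and> m < int n then fourier_coeff f m else 0)"
proof -
  have "fourier_coeff (analytic_sum f n) m =
      (\<Sum>k<n. if k = nat m \<and> 0 \<le> m then fourier_coeff f m else 0)"
    unfolding fourier_coeff_eq_cinner cinner_analytic_sum fourier_coeff_monomial
    by (intro sum.cong) (auto simp: fourier_coeff_monomial fourier_coeff_eq_cinner[symmetric])
  then show ?thesis by auto
qed

text \<open>The partial sum \<open>?s\<close> has the same inner product with \<open>f\<close> as
  with itself, so the squared norm of \<open>f - ?s\<close> is the difference of the two
  sides.\<close>

lemma bessel_inequality:
  "(\<Sum>k<n. (cmod (fourier_coeff f (int k)))\<^sup>2) \<le> Re (cinner f f)"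
proof -
  let ?s = "analytic_sum f n"
  have sf: "cinner ?s f = of_real (\<Sum>k<n. (cmod (fourier_coeff f (int k)))\<^sup>2)"
    unfolding cinner_analytic_sum by (simp add: mult_cnj_cmod)
  have ss: "cinner ?s ?s = of_real (\<Sum>k<n. (cmod (fourier_coeff f (int k)))\<^sup>2)"
    unfolding cinner_analytic_sum by (simp add: mult_cnj_cmod fourier_coeff_analytic_sum)
  have fs: "cinner f ?s = of_real (\<Sum>k<n. (cmod (fourier_coeff f (int k)))\<^sup>2)"
    by (subst cinner_commute) (simp add: sf)
  have "0 \<le> Re (cinner (f - ?s) (f - ?s))" by (rule cinner_ge_zero)
  also have "\<dots> = Re (cinner f f) - (\<Sum>k<n. (cmod (fourier_coeff f (int k)))\<^sup>2)"
    by (simp add: cinner_diff_left cinner_diff_right sf ss fs)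
  finally show ?thesis by simp
qed

text \<open>The squared distance of two partial sums is a block of the series of squared
  coefficients, which converges by Bessel's inequality.\<close>

lemma analytic_sum_convergent:
  obtains g where "(\<lambda>n. Re (cinner (analytic_sum f n - g) (analytic_sum f n - g))) \<longlonglongrightarrow> 0"
proof (rule L2_complete[of "analytic_sum f"])
  define a where "a k = (cmod (fourier_coeff f (int k)))\<^sup>2" for k
  have dist: "Re (cinner (analytic_sum f i - analytic_sum f j) (analytic_sum f i - analytic_sum f j)) =
      (\<Sum>k=j..<i. a k)" if "j \<le> i" for i j
  proof -
    have "{..<i} = {..<j} \<union> {j..<i}" "{..<j} \<inter> {j..<i} = {}" using that by auto
    then have eq: "analytic_sum f i - analytic_sum f j = (\<Sum>k=j..<i. fourier_coeff f (int k) *\<^sub>C monomial (int k))"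
      unfolding analytic_sum_def by (simp add: sum.union_disjoint)
    have "cinner (analytic_sum f i - analytic_sum f j) (analytic_sum f i - analytic_sum f j) =
       (\<Sum>k=j..<i. fourier_coeff f (int k) * cnj (fourier_coeff (analytic_sum f i - analytic_sum f j) (int k)))"
      by (subst (1) eq) (simp add: cinner_sum_left cinner_scaleC_left cinner_monomial_left)
    also have "\<dots> = of_real (\<Sum>k=j..<i. a k)"
      by (simp add: a_def fourier_coeff_diff fourier_coeff_analytic_sum mult_cnj_cmod)
    finally show ?thesis by simp
  qed
  fix e :: real assume "e > 0"
  have "summable a"
    unfolding a_def by (rule summableI_nonneg_bounded[OF _ bessel_inequality]) simp
  then obtain N where N: "\<And>m n. m \<ge> N \<Longrightarrow> norm (sum a {m..<n}) < e"
    using \<open>e > 0\<close> summable_Cauchy[of a] by blast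
  have sym: "cinner (x - y) (x - y) = cinner (y - x) (y - x)" for x y :: L2
    by (simp add: cinner_diff_left cinner_diff_right)
  have "Re (cinner (analytic_sum f i - analytic_sum f j) (analytic_sum f i - analytic_sum f j)) < e"
    if "i \<ge> N" "j \<ge> N" for i j
    using dist[of i j] dist[of j i] N[of i j] N[of j i] that sym[of "analytic_sum f i" "analytic_sum f j"]
    by (cases "j \<le> i") auto
  then show "\<exists>N. \<forall>i\<ge>N. \<forall>j\<ge>N.
      Re (cinner (analytic_sum f i - analytic_sum f j) (analytic_sum f i - analytic_sum f j)) < e"
    by blast
qed

lemma cinner_tendsto:
  assumes "(\<lambda>n. Re (cinner (x n - g) (x n - g))) \<longlonglongrightarrow> 0"
  shows "(\<lambda>n. cinner (x n) y) \<longlonglongrightarrow> cinner g y"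
proof -
  have "(\<lambda>n. (cmod (cinner (x n - g) y))\<^sup>2) \<longlonglongrightarrow> 0"
  proof (rule tendsto_sandwich[OF always_eventually always_eventually tendsto_const])
    show "(\<lambda>n. Re (cinner (x n - g) (x n - g)) * Re (cinner y y)) \<longlonglongrightarrow> 0"
      using tendsto_mult_left_zero[OF assms] .
  qed (use Cauchy_Schwarz_cinner in auto)
  then have "(\<lambda>n. sqrt ((cmod (cinner (x n - g) y))\<^sup>2)) \<longlonglongrightarrow> sqrt 0"
    by (rule tendsto_real_sqrt)
  then have "(\<lambda>n. cinner (x n - g) y) \<longlonglongrightarrow> 0"
    by (simp add: tendsto_norm_zero_iff)
  then show ?thesis by (simp add: cinner_diff_left LIM_zero_iff)
qed

text \<open>Each coefficient of the partial sums is eventually constant, which identifies the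
  coefficients of the limit. The weak convergence is recorded because it carries orthogonality from
  the partial sums over to \<open>g\<close>.\<close>

lemma analytic_part_exists:
  "\<exists>g. (\<forall>n. fourier_coeff g n = (if n \<ge> 0 then fourier_coeff f n else 0)) \<and>
      (\<forall>y. (\<lambda>n. cinner (analytic_sum f n) y) \<longlonglongrightarrow> cinner g y)"
proof -
  obtain g where "(\<lambda>n. Re (cinner (analytic_sum f n - g) (analytic_sum f n - g))) \<longlonglongrightarrow> 0"
    by (rule analytic_sum_convergent)
  then have lim: "(\<lambda>n. cinner (analytic_sum f n) y) \<longlonglongrightarrow> cinner g y" for y
    by (rule cinner_tendsto)
  have "fourier_coeff g m = (if m \<ge> 0 then fourier_coeff f m else 0)" for m
  proof -
    have "eventually (\<lambda>n. fourier_coeff (analytic_sum f n) m = (if m \<ge> 0 then fourier_coeff f m else 0)) sequentially"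
      using eventually_gt_at_top[of "nat m"] by eventually_elim (auto simp: fourier_coeff_analytic_sum)
    then have "(\<lambda>n. fourier_coeff (analytic_sum f n) m) \<longlonglongrightarrow> (if m \<ge> 0 then fourier_coeff f m else 0)"
      by (rule tendsto_eventually)
    with lim[of "monomial m"] show ?thesis
      by (simp add: fourier_coeff_eq_cinner LIMSEQ_unique)
  qed
  with lim show ?thesis by blast
qed

text \<open>This is the orthogonal complement of H^2 in L^2, also described as the complex
  conjugates of z H^2.\<close>

definition H2_minus :: "L2 set" where
  "H2_minus = {f. \<forall>n\<ge>0. fourier_coeff f n = 0}"

lemma L2_decomposition:
  obtains g h where "g \<in> H2" "h \<in> H2_minus" "f = g + h"
proof -
  obtain g where "\<And>n. fourier_coeff g n = (if n \<ge> 0 then fourier_coeff f n else 0)"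
    using analytic_part_exists[of f] by blast
  then show ?thesis
    by (intro that[of g "f - g"]) (auto simp: H2_def H2_minus_def fourier_coeff_diff)
qed

text \<open>By uniqueness of coefficients \<open>f\<close> is its own analytic part, hence a weak
  limit of combinations of monomials orthogonal to \<open>y\<close>.\<close>

lemma cinner_H2_H2_minus:
  assumes "f \<in> H2" "y \<in> H2_minus"
  shows "cinner f y = 0"
proof -
  obtain g where g: "\<And>n. fourier_coeff g n = (if n \<ge> 0 then fourier_coeff f n else 0)"
    and lim: "\<And>y. (\<lambda>n. cinner (analytic_sum f n) y) \<longlonglongrightarrow> cinner g y"
    using analytic_part_exists[of f] by blast
  have "g = f"
  proof (rule L2_eqI)
    show "fourier_coeff g n = fourier_coeff f n" for n
      using g assms(1) by (cases "n \<ge> 0") (auto simp: H2_def)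
  qed
  moreover have "cinner (analytic_sum f n) y = 0" for n
    using assms(2) by (simp add: cinner_analytic_sum H2_minus_def)
  ultimately show ?thesis using lim[of y] by (simp add: LIMSEQ_const_iff)
qed

section \<open>Unimodular multipliers and the frequency flip\<close>

text \<open>Modulus one is required at every point of the circle, not just almost everywhere, so
  that the integrands below agree pointwise.\<close>

definition unimodular :: "(complex \<Rightarrow> complex) \<Rightarrow> bool" where
  "unimodular \<psi> \<longleftrightarrow> \<psi> \<in> borel_measurable circle_measure \<and> (\<forall>z. cmod z = 1 \<longrightarrow> cmod (\<psi> z) = 1)"

lemma square_integrable_unimodular_mult:
  assumes "unimodular \<psi>" "square_integrable f"
  shows "square_integrable (\<lambda>z. \<psi> z * f z)"
proof -
  have "integrable circle_measure (\<lambda>z. (cmod (\<psi> z * f z))\<^sup>2) \<longleftrightarrow>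
      integrable circle_measure (\<lambda>z. (cmod (f z))\<^sup>2)"
    using assms(1) by (intro Bochner_Integration.integrable_cong)
       (auto simp: space_circle_measure unimodular_def norm_mult)
  then show ?thesis
    using assms by (auto simp: square_integrable_def unimodular_def)
qed

text \<open>For multipliers that are not unimodular this is the identity, a junk value.\<close>

lift_definition mult_by :: "(complex \<Rightarrow> complex) \<Rightarrow> L2 \<Rightarrow> L2" is
  "\<lambda>\<psi> f. if unimodular \<psi> then \<lambda>z. \<psi> z * f z else f"
  by (auto simp: square_integrable_unimodular_mult)

lemma unimodular_cnj: "unimodular \<psi> \<Longrightarrow> unimodular (\<lambda>z. cnj (\<psi> z))"
  by (auto simp: unimodular_def intro: borel_measurable_cnj)

lemma unimodular_id: "unimodular (\<lambda>z. z)"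
  by (auto simp: unimodular_def intro: borel_measurable_circle_measure)

lemma mult_by_add: "mult_by \<psi> (f + g) = mult_by \<psi> f + mult_by \<psi> g"
  by transfer (auto simp: distrib_left intro!: square_integrable_add square_integrable_unimodular_mult)

lemma mult_by_scaleC: "mult_by \<psi> (c *\<^sub>C f) = c *\<^sub>C mult_by \<psi> f"
  by transfer (auto simp: mult.left_commute intro!: square_integrable_mult_left square_integrable_unimodular_mult)

lemma cinner_mult_by: "cinner (mult_by \<psi> f) (mult_by \<psi> g) = cinner f g"
proof transfer
  fix \<psi> f g :: "complex \<Rightarrow> complex"
  show "(LINT z|circle_measure. (if unimodular \<psi> then \<lambda>z. \<psi> z * f z else f) z *
          cnj ((if unimodular \<psi> then \<lambda>z. \<psi> z * g z else g) z)) =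
        (LINT z|circle_measure. f z * cnj (g z))"
  proof (cases "unimodular \<psi>")
    case True
    have "\<psi> z * f z * cnj (\<psi> z * g z) = f z * cnj (g z)" if "z \<in> space circle_measure" for z
    proof -
      have "\<psi> z * cnj (\<psi> z) = 1"
        using that True by (simp add: mult_cnj_cmod unimodular_def space_circle_measure)
      moreover have "\<psi> z * f z * cnj (\<psi> z * g z) = (\<psi> z * cnj (\<psi> z)) * (f z * cnj (g z))"
        by (simp add: mult_ac)
      ultimately show ?thesis by simp
    qed
    then have "(LINT z|circle_measure. \<psi> z * f z * cnj (\<psi> z * g z)) = (LINT z|circle_measure. f z * cnj (g z))"
      by (intro Bochner_Integration.integral_cong refl)
    then show ?thesis using True by (simp del: complex_cnj_mult)
  qed simp
qed

lemma mult_by_mult_by_cnj: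
  assumes "unimodular \<psi>"
  shows "mult_by \<psi> (mult_by (\<lambda>z. cnj (\<psi> z)) f) = f"
  using assms
proof transfer
  fix \<psi> f :: "complex \<Rightarrow> complex"
  assume \<psi>: "unimodular \<psi>" and "square_integrable f \<and> square_integrable f \<and> (AE z in circle_measure. f z = f z)"
  then have f: "square_integrable f" by simp
  have "\<psi> z * (cnj (\<psi> z) * f z) = f z" if "z \<in> space circle_measure" for z
  proof -
    have "\<psi> z * cnj (\<psi> z) = 1"
      using that \<psi> by (simp add: mult_cnj_cmod unimodular_def space_circle_measure)
    then show ?thesis by (simp flip: mult.assoc)
  qed
  then show "square_integrable (if unimodular \<psi>
          then \<lambda>z. \<psi> z * (if unimodular (\<lambda>z. cnj (\<psi> z)) then \<lambda>z. cnj (\<psi> z) * f z else f) z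
          else if unimodular (\<lambda>z. cnj (\<psi> z)) then \<lambda>z. cnj (\<psi> z) * f z else f) \<and>
      square_integrable f \<and>
      (AE z in circle_measure. (if unimodular \<psi>
          then \<lambda>z. \<psi> z * (if unimodular (\<lambda>z. cnj (\<psi> z)) then \<lambda>z. cnj (\<psi> z) * f z else f) z
          else if unimodular (\<lambda>z. cnj (\<psi> z)) then \<lambda>z. cnj (\<psi> z) * f z else f) z = f z)"
    using \<psi> f by (auto simp: unimodular_cnj square_integrable_unimodular_mult)
qed

lemma mult_z_eq_mult_by: "mult_z f = mult_by (\<lambda>z. z) f"
  by transfer (use square_integrable_unimodular_mult[OF unimodular_id] in \<open>auto simp: unimodular_id\<close>)

lemma mult_by_mult_z: "mult_by \<psi> (mult_z f) = mult_z (mult_by \<psi> f)"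
  by transfer
    (auto simp: mult.left_commute intro!: square_integrable_unimodular_mult square_integrable_unimodular_mult[OF unimodular_id, simplified])

lemma fourier_coeff_mult_z: "fourier_coeff (mult_z f) n = fourier_coeff f (n - 1)"
proof transfer
  fix f :: "complex \<Rightarrow> complex" and n :: int
  show "(LINT z|circle_measure. z * f z * cnj (z powi n)) = (LINT z|circle_measure. f z * cnj (z powi (n - 1)))"
  proof (rule Bochner_Integration.integral_cong[OF refl])
    fix z assume "z \<in> space circle_measure"
    then have z: "cmod z = 1" by (simp add: space_circle_measure)
    have "z powi (- (n - 1)) = z powi 1 * z powi (- n)"
      unfolding powi_add_circle[OF z, symmetric] by simp
    then show "z * f z * cnj (z powi n) = f z * cnj (z powi (n - 1))"
      by (simp only: cnj_powi_circle[OF z] power_int_1_right mult_ac)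
  qed
qed

lemma fourier_coeff_div_z: "fourier_coeff (div_z f) n = fourier_coeff f (n + 1)"
proof transfer
  fix f :: "complex \<Rightarrow> complex" and n :: int
  show "(LINT z|circle_measure. f z / z * cnj (z powi n)) = (LINT z|circle_measure. f z * cnj (z powi (n + 1)))"
  proof (rule Bochner_Integration.integral_cong[OF refl])
    fix z assume "z \<in> space circle_measure"
    then have z: "cmod z = 1" by (simp add: space_circle_measure)
    have "z powi (- (n + 1)) = z powi (- 1) * z powi (- n)"
      by (subst powi_add_circle[OF z, symmetric]) (rule arg_cong, simp)
    then show "f z / z * cnj (z powi n) = f z * cnj (z powi (n + 1))"
      by (simp add: cnj_powi_circle[OF z] power_int_minus divide_inverse mult_ac del: complex_cnj_power_int)
  qed
qed

lemma const_L2_eq_monomial: "const_L2 c = c *\<^sub>C monomial 0"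
  by transfer (simp add: square_integrable_const)

lemma fourier_coeff_const: "fourier_coeff (const_L2 c) n = (if n = 0 then c else 0)"
  by (simp add: const_L2_eq_monomial fourier_coeff_scaleC fourier_coeff_monomial)

lemma fourier_coeff_shift: "fourier_coeff (shift f) n = fourier_coeff f (n - 1)"
  by (simp add: shift_def fourier_coeff_mult_z)

text \<open>Subtracting the constant removes the coefficient at 0, which division by
  \<open>z\<close> would have moved to index -1.\<close>

lemma fourier_coeff_backward_shift:
  "fourier_coeff (backward_shift f) n = (if n = - 1 then 0 else fourier_coeff f (n + 1))"
  by (simp add: backward_shift_def fourier_coeff_div_z fourier_coeff_diff fourier_coeff_const disk_ext_0)

section \<open>The frequency flip\<close>

lemma integral_cnj_circle:
  assumes "f \<in> borel_measurable circle_measure"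
  shows "(LINT z|circle_measure. f (cnj z)) = (LINT z|circle_measure. f z :: complex)"
  using integral_distr[OF cnj_measurable_circle assms] by (simp add: distr_cnj_circle_measure)

lemma square_integrable_reflect:
  assumes "square_integrable f"
  shows "square_integrable (\<lambda>z. f (cnj z) / z)"
proof (rule square_integrable_div_z)
  have "integrable (distr circle_measure circle_measure cnj) (\<lambda>z. (cmod (f z))\<^sup>2)"
    using assms by (simp add: distr_cnj_circle_measure square_integrable_def)
  then have "integrable circle_measure (\<lambda>z. (cmod (f (cnj z)))\<^sup>2)"
    using integrable_distr[OF cnj_measurable_circle] by blast
  then show "square_integrable (\<lambda>z. f (cnj z))"
    using assms measurable_compose[OF cnj_measurable_circle] by (auto simp: square_integrable_def)
qed

text \<open>On the circle \<open>cnj z\<close> is 1/z. The division by \<open>z\<close> turns the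
  index map into n \<mapsto> -n-1, which exchanges the nonnegative and the negative integers
  exactly. Equality almost everywhere is respected because conjugation preserves the
  measure.\<close>

lift_definition reflect :: "L2 \<Rightarrow> L2" is "\<lambda>f z. f (cnj z) / z"
proof -
  fix f g :: "complex \<Rightarrow> complex"
  assume fg: "square_integrable f \<and> square_integrable g \<and> (AE z in circle_measure. f z = g z)"
  then have "AE z in distr circle_measure circle_measure cnj. f z = g z"
    unfolding distr_cnj_circle_measure by blast
  then have "AE z in circle_measure. f (cnj z) = g (cnj z)"
    by (rule AE_distrD[OF cnj_measurable_circle])
  then show "square_integrable (\<lambda>z. f (cnj z) / z) \<and> square_integrable (\<lambda>z. g (cnj z) / z) \<and>
      (AE z in circle_measure. f (cnj z) / z = g (cnj z) / z)"
    using fg by (auto simp: square_integrable_reflect)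
qed

lemma cinner_reflect: "cinner (reflect f) (reflect g) = cinner f g"
proof transfer
  fix f g :: "complex \<Rightarrow> complex"
  assume "square_integrable f \<and> square_integrable f \<and> (AE z in circle_measure. f z = f z)"
    "square_integrable g \<and> square_integrable g \<and> (AE z in circle_measure. g z = g z)"
  then have m: "(\<lambda>z. f z * cnj (g z)) \<in> borel_measurable circle_measure"
    by (auto simp: square_integrable_def intro!: borel_measurable_times borel_measurable_cnj)
  have "(LINT z|circle_measure. f (cnj z) / z * cnj (g (cnj z) / z)) =
      (LINT z|circle_measure. f (cnj z) * cnj (g (cnj z)))"
  proof (rule Bochner_Integration.integral_cong[OF refl])
    fix z assume "z \<in> space circle_measure"
    then have z: "z * cnj z = 1" by (simp add: space_circle_measure mult_cnj_cmod)
    have "f (cnj z) / z * cnj (g (cnj z) / z) = f (cnj z) * cnj (g (cnj z)) / (z * cnj z)"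
      by simp
    then show "f (cnj z) / z * cnj (g (cnj z) / z) = f (cnj z) * cnj (g (cnj z))"
      using z by simp
  qed
  also have "\<dots> = (LINT z|circle_measure. f z * cnj (g z))"
    by (rule integral_cnj_circle[OF m])
  finally show "(LINT z|circle_measure. f (cnj z) / z * cnj (g (cnj z) / z)) =
      (LINT z|circle_measure. f z * cnj (g z))" .
qed

lemma fourier_coeff_reflect: "fourier_coeff (reflect f) n = fourier_coeff f (- n - 1)"
proof transfer
  fix f :: "complex \<Rightarrow> complex" and n :: int
  assume "square_integrable f \<and> square_integrable f \<and> (AE z in circle_measure. f z = f z)"
  then have m: "(\<lambda>z. f z * cnj (z powi (- n - 1))) \<in> borel_measurable circle_measure"
    by (auto simp: square_integrable_def intro!: borel_measurable_times borel_measurable_cnj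
        borel_measurable_circle_measure[OF borel_measurable_power_int] simp del: complex_cnj_power_int)
  have "(LINT z|circle_measure. f (cnj z) / z * cnj (z powi n)) =
      (LINT z|circle_measure. f (cnj z) * cnj (cnj z powi (- n - 1)))"
  proof (rule Bochner_Integration.integral_cong[OF refl])
    fix z assume "z \<in> space circle_measure"
    then have z: "cmod z = 1" by (simp add: space_circle_measure)
    have "z powi (- n - 1) = z powi (- 1) * z powi (- n)"
      by (subst powi_add_circle[OF z, symmetric]) (rule arg_cong, simp)
    then show "f (cnj z) / z * cnj (z powi n) = f (cnj z) * cnj (cnj z powi (- n - 1))"
      using cnj_powi_circle[OF z, of n] by (simp add: power_int_minus divide_inverse mult_ac)
  qed
  also have "\<dots> = (LINT z|circle_measure. f z * cnj (z powi (- n - 1)))"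
    by (rule integral_cnj_circle[OF m])
  finally show "(LINT z|circle_measure. f (cnj z) / z * cnj (z powi n)) =
      (LINT z|circle_measure. f z * cnj (z powi (- n - 1)))" .
qed

lemma reflect_add: "reflect (f + g) = reflect f + reflect g"
  by (rule L2_eqI) (simp add: fourier_coeff_reflect fourier_coeff_add)

lemma reflect_scaleC: "reflect (c *\<^sub>C f) = c *\<^sub>C reflect f"
  by (rule L2_eqI) (simp add: fourier_coeff_reflect fourier_coeff_scaleC)

lemma reflect_reflect: "reflect (reflect f) = f"
  by (rule L2_eqI) (simp add: fourier_coeff_reflect)

lemma reflect_in_H2_minus_iff: "reflect f \<in> H2_minus \<longleftrightarrow> f \<in> H2"
proof
  assume "reflect f \<in> H2_minus"
  then have "fourier_coeff f n = 0" if "n < 0" for n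
    using that fourier_coeff_reflect[of f "- n - 1"] by (simp add: H2_minus_def)
  then show "f \<in> H2" by (simp add: H2_def)
next
  assume "f \<in> H2"
  then show "reflect f \<in> H2_minus"
    by (simp add: H2_def H2_minus_def fourier_coeff_reflect)
qed

text \<open>The coefficient of \<open>f\<close> at 0 sits at index -1 of \<open>reflect f\<close>.
  Multiplication by \<open>z\<close> moves it to index 0, where the constant cancels it.\<close>

lemma reflect_backward_shift:
  "reflect (backward_shift f) = mult_z (reflect f) - const_L2 (fourier_coeff f 0)"
  by (rule L2_eqI) (simp add: fourier_coeff_reflect fourier_coeff_backward_shift fourier_coeff_diff
      fourier_coeff_mult_z fourier_coeff_const)

section \<open>Boundary values of inner functions\<close>

lemma has_radial_limit_unique:
  "has_radial_limit u z w \<Longrightarrow> has_radial_limit u z w' \<Longrightarrow> w = w'"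
  unfolding has_radial_limit_def using tendsto_unique[OF trivial_limit_at_left_real] by blast

lemma boundary_value_eqI: "has_radial_limit u z w \<Longrightarrow> boundary_value u z = w"
  unfolding boundary_value_def by (blast intro: has_radial_limit_unique)

text \<open>A sequence of radii tending to 1 from below: measurability of limits and dominated
  convergence are applied to sequences.\<close>

definition radius :: "nat \<Rightarrow> real" where
  "radius k = 1 - inverse (real (Suc k))"

lemma radius_bounds: "0 \<le> radius k" "radius k < 1"
  by (auto simp: radius_def field_simps)

lemma filterlim_radius: "filterlim radius (at_left 1) sequentially"
proof (rule filterlim_at[THEN iffD2], intro conjI)
  show "radius \<longlonglongrightarrow> 1"
    unfolding radius_def using tendsto_diff[OF tendsto_const LIMSEQ_inverse_real_of_nat, of 1] by simp
  show "\<forall>\<^sub>F k in sequentially. radius k \<in> {..<1} \<and> radius k \<noteq> 1"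
    using radius_bounds(2) by (auto intro!: always_eventually simp: less_imp_neq)
qed

lemma has_radial_limit_radius:
  "has_radial_limit u z w \<Longrightarrow> (\<lambda>k. u (of_real (radius k) * z)) \<longlonglongrightarrow> w"
  unfolding has_radial_limit_def using filterlim_compose filterlim_radius by blast

lemma dilation_measurable:
  assumes "u holomorphic_on ball 0 1" "0 \<le> r" "r < 1"
  shows "(\<lambda>z. u (of_real r * z)) \<in> borel_measurable circle_measure"
proof -
  have "continuous_on (sphere 0 1) (\<lambda>z. u (of_real r * z))"
    using assms
    by (intro continuous_on_compose2[OF holomorphic_on_imp_continuous_on[OF assms(1)]] continuous_intros)
      (auto simp: norm_mult)
  then have "(\<lambda>z. u (of_real r * z)) \<in> borel_measurable (restrict_space borel (sphere 0 1))"
    by (intro borel_measurable_continuous_on_restrict)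
  then show ?thesis
    by (subst measurable_cong_sets[OF sets_circle_measure refl])
qed

text \<open>\<^term>\<open>boundary_value u\<close> itself need not be measurable, since \<^term>\<open>circle_measure\<close> is not complete.\<close>

lemma inner_function_boundary:
  assumes "inner_function u"
  obtains \<psi> where "unimodular \<psi>" "AE z in circle_measure. has_radial_limit u z (\<psi> z)"
proof -
  have hol: "u holomorphic_on ball 0 1" using assms by (simp add: inner_function_def)
  define L where "L z = lim (\<lambda>k. u (of_real (radius k) * z))" for z
  have L [measurable]: "L \<in> borel_measurable circle_measure"
    unfolding L_def using hol radius_bounds by (intro borel_measurable_lim_metric dilation_measurable)
  \<comment> \<open>The replacement value 1 gives modulus one everywhere on the circle; almost
    everywhere \<open>L\<close> is the radial limit and is left unchanged.\<close>
  define \<psi> where "\<psi> z = (if cmod (L z) = 1 then L z else 1)" for z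
  have "\<psi> \<in> borel_measurable circle_measure"
    unfolding \<psi>_def by measurable
  then have "unimodular \<psi>"
    by (auto simp: unimodular_def \<psi>_def)
  moreover have "AE z in circle_measure. \<exists>w. has_radial_limit u z w \<and> cmod w = 1"
    using assms by (simp add: inner_function_def)
  then have "AE z in circle_measure. has_radial_limit u z (\<psi> z)"
  proof eventually_elim
    case (elim z)
    then obtain w where w: "has_radial_limit u z w" "cmod w = 1" by blast
    then have "L z = w"
      unfolding L_def by (intro limI has_radial_limit_radius)
    then show ?case using w by (simp add: \<psi>_def)
  qed
  ultimately show ?thesis by (rule that)
qed

text \<open>The power series of \<open>u\<close> converges absolutely and uniformly on the circle of
  radius \<open>r\<close>, so it can be integrated termwise against \<open>h\<close>. The factor
  \<open>z ^ j\<close> lowers the index of the coefficient of \<open>h\<close> by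
  \<open>j\<close>.\<close>

lemma dilation_fourier_sums:
  assumes "u holomorphic_on ball 0 1" "0 \<le> r" "r < 1" "integrable circle_measure h"
  shows "(\<lambda>j. (deriv ^^ j) u 0 / fact j * of_real r ^ j *
        (LINT z|circle_measure. h z * cnj (z powi (n - int j)))) sums
      (LINT z|circle_measure. u (of_real r * z) * h z * cnj (z powi n))"
proof -
  define a where "a j = (deriv ^^ j) u 0 / fact j" for j
  define F where "F j z = a j * of_real r ^ j * (h z * cnj (z powi (n - int j)))" for j z
  have power_series: "(\<lambda>j. a j * w ^ j) sums u w" if "cmod w < 1" for w
    using holomorphic_power_series[OF assms(1), of w] that by (simp add: a_def)
  have cnj_powi: "cnj (z powi (n - int j)) = z ^ j * cnj (z powi n)" if "cmod z = 1" for j z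
  proof -
    have "cnj (z powi (n - int j)) = z powi (int j + (- n))"
      by (simp add: cnj_powi_circle[OF that] del: complex_cnj_power_int)
    also have "\<dots> = z ^ j * cnj (z powi n)"
      by (simp only: powi_add_circle[OF that] cnj_powi_circle[OF that] power_int_of_nat)
    finally show ?thesis .
  qed
  have norm_F: "cmod (F j z) = cmod (a j) * r ^ j * cmod (h z)" if "cmod z = 1" for j z
    using that assms(2) by (simp add: F_def norm_mult norm_power norm_power_int)
  have summable: "summable (\<lambda>j. cmod (a j) * r ^ j)"
  proof -
    \<comment> \<open>A point strictly between \<open>r\<close> and 1: convergence there forces
      absolute convergence at \<open>r\<close>.\<close>
    define s where "s = (1 + r) / 2"
    have s: "0 < s" "s < 1" "r < s" using assms(2,3) by (auto simp: s_def)
    have "summable (\<lambda>j. a j * of_real s ^ j)"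
      using power_series[of "of_real s"] s by (auto simp: sums_iff)
    then have "summable (\<lambda>j. norm (a j * of_real r ^ j))"
      by (rule powser_insidea) (use s assms(2) in simp)
    then show ?thesis using assms(2) by (simp add: norm_mult norm_power)
  qed
  have "(\<lambda>j. LINT z|circle_measure. F j z) sums (LINT z|circle_measure. (\<Sum>j. F j z))"
  proof (rule sums_integral)
    show int: "integrable circle_measure (F j)" for j
    proof -
      have "integrable circle_measure (\<lambda>z. cnj (z powi (n - int j)) * h z)"
        using assms(4) by (intro integrable_circle_unimodular_mult[where C = 1] borel_measurable_cnj
            borel_measurable_circle_measure[OF borel_measurable_power_int])
          (auto simp: norm_power_int simp del: complex_cnj_power_int)
      then show ?thesis unfolding F_def by (simp add: mult.commute)
    qed
    show "AE z in circle_measure. summable (\<lambda>j. norm (F j z))"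
    proof (rule AE_I2)
      fix z assume "z \<in> space circle_measure"
      then have "cmod z = 1" by (simp add: space_circle_measure)
      then show "summable (\<lambda>j. norm (F j z))"
        using summable by (simp add: norm_F summable_mult2)
    qed
    have "(LINT z|circle_measure. cmod (F j z)) = cmod (a j) * r ^ j * (LINT z|circle_measure. cmod (h z))" for j
    proof -
      have "(LINT z|circle_measure. cmod (F j z)) = (LINT z|circle_measure. cmod (a j) * r ^ j * cmod (h z))"
        by (intro Bochner_Integration.integral_cong) (auto simp: norm_F space_circle_measure)
      then show ?thesis by simp
    qed
    then show "summable (\<lambda>j. LINT z|circle_measure. cmod (F j z))"
      using summable by (simp add: summable_mult2)
  qed
  moreover have "(LINT z|circle_measure. (\<Sum>j. F j z)) =
      (LINT z|circle_measure. u (of_real r * z) * h z * cnj (z powi n))"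
  proof (rule Bochner_Integration.integral_cong[OF refl])
    fix z assume "z \<in> space circle_measure"
    then have z: "cmod z = 1" by (simp add: space_circle_measure)
    have "(\<lambda>j. a j * (of_real r * z) ^ j * (h z * cnj (z powi n))) sums
        (u (of_real r * z) * (h z * cnj (z powi n)))"
      by (intro sums_mult2 power_series) (use z assms in \<open>simp add: norm_mult\<close>)
    moreover have "F j z = a j * (of_real r * z) ^ j * (h z * cnj (z powi n))" for j
      unfolding F_def cnj_powi[OF z] by (simp add: power_mult_distrib)
    ultimately show "(\<Sum>j. F j z) = u (of_real r * z) * h z * cnj (z powi n)"
      by (simp add: sums_iff mult.assoc)
  qed
  ultimately show ?thesis by (simp add: F_def a_def)
qed

text \<open>The coefficient is the limit, as the radius tends to 1, of the sums from
  \<open>dilation_fourier_sums\<close>. By \<open>zero\<close> each summand has a vanishing factor,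
  and the bound on \<open>u\<close> provides the dominating function.\<close>

lemma fourier_coeff_inner_mult_eq_zero:
  assumes "inner_function u" "unimodular \<psi>" "AE z in circle_measure. has_radial_limit u z (\<psi> z)"
    and zero: "\<And>j. (deriv ^^ j) u 0 = 0 \<or> fourier_coeff h (n - int j) = 0"
  shows "fourier_coeff (mult_by \<psi> h) n = 0"
proof -
  obtain f where f: "square_integrable f" and h: "h = abs_L2 f" by (rule abs_L2_cases)
  have hol: "u holomorphic_on ball 0 1" and "bounded (u ` ball 0 1)"
    using assms(1) by (auto simp: inner_function_def)
  then obtain B where B: "\<And>w. cmod w < 1 \<Longrightarrow> cmod (u w) \<le> B"
    by (auto simp: bounded_iff) (metis mem_ball_0)
  have fi: "integrable circle_measure f" using f by (rule square_integrable_imp_integrable_circle)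
  have [measurable]: "f \<in> borel_measurable circle_measure" "\<psi> \<in> borel_measurable circle_measure"
    using f assms(2) by (auto simp: square_integrable_def unimodular_def)
  have mp: "(\<lambda>z. cnj (z powi n)) \<in> borel_measurable circle_measure"
    by (intro borel_measurable_cnj borel_measurable_circle_measure[OF borel_measurable_power_int])
  have coeff: "fourier_coeff h m = (LINT z|circle_measure. f z * cnj (z powi m))" for m
    unfolding h using f by (simp add: fourier_coeff.abs_eq del: complex_cnj_power_int)
  have "(LINT z|circle_measure. u (of_real (radius k) * z) * f z * cnj (z powi n)) = 0" for k
  proof -
    have "(deriv ^^ j) u 0 / fact j * of_real (radius k) ^ j *
        (LINT z|circle_measure. f z * cnj (z powi (n - int j))) = 0" for j
      using zero[of j] unfolding coeff by auto
    then have "(\<lambda>j. 0) sums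
        (LINT z|circle_measure. u (of_real (radius k) * z) * f z * cnj (z powi n))"
      using dilation_fourier_sums[OF hol radius_bounds fi, of k n] by (simp only:)
    then show ?thesis using sums_unique2[OF sums_zero] by metis
  qed
  moreover have "(\<lambda>k. LINT z|circle_measure. u (of_real (radius k) * z) * f z * cnj (z powi n)) \<longlonglongrightarrow>
      (LINT z|circle_measure. \<psi> z * f z * cnj (z powi n))"
  proof (rule integral_dominated_convergence)
    show "integrable circle_measure (\<lambda>z. B * cmod (f z))" using fi by simp
    show "AE z in circle_measure. (\<lambda>k. u (of_real (radius k) * z) * f z * cnj (z powi n)) \<longlonglongrightarrow>
        \<psi> z * f z * cnj (z powi n)"
      using assms(3) by eventually_elim (intro tendsto_intros has_radial_limit_radius)
    show "AE z in circle_measure. norm (u (of_real (radius k) * z) * f z * cnj (z powi n)) \<le> B * cmod (f z)" for k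
    proof (rule AE_I2)
      fix z assume "z \<in> space circle_measure"
      then have "cmod z = 1" by (simp add: space_circle_measure)
      then show "norm (u (of_real (radius k) * z) * f z * cnj (z powi n)) \<le> B * cmod (f z)"
        using radius_bounds[of k] B[of "of_real (radius k) * z"]
        by (auto simp: norm_mult norm_power_int intro!: mult_right_mono)
    qed
    show "(\<lambda>z. u (of_real (radius k) * z) * f z * cnj (z powi n)) \<in> borel_measurable circle_measure" for k
      by (intro borel_measurable_times mp dilation_measurable hol radius_bounds) measurable
    show "(\<lambda>z. \<psi> z * f z * cnj (z powi n)) \<in> borel_measurable circle_measure"
      by (intro borel_measurable_times mp) measurable
  qed
  ultimately have "(LINT z|circle_measure. \<psi> z * f z * cnj (z powi n)) = 0"
    by (simp add: LIMSEQ_const_iff del: complex_cnj_power_int)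
  moreover have "fourier_coeff (mult_by \<psi> h) n = (LINT z|circle_measure. \<psi> z * f z * cnj (z powi n))"
    using f assms(2)
    by (simp add: h mult_by.abs_eq fourier_coeff.abs_eq square_integrable_unimodular_mult del: complex_cnj_power_int)
  ultimately show ?thesis by simp
qed

text \<open>This replaces the relation built on \<open>boundary_value\<close> by an operator with a
  measurable symbol, so that the set in \<open>model_space\<close> becomes an image of
  \<open>H2\<close>.\<close>

lemma is_mult_iff_mult_by:
  assumes "unimodular \<psi>" "AE z in circle_measure. \<phi> z = \<psi> z"
  shows "is_mult \<phi> h f \<longleftrightarrow> f = mult_by \<psi> h"
  using assms
proof transfer
  fix \<psi> \<phi> h f :: "complex \<Rightarrow> complex"
  assume \<psi>: "unimodular \<psi>" and ae: "AE z in circle_measure. \<phi> z = \<psi> z"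
    and "square_integrable h \<and> square_integrable h \<and> (AE z in circle_measure. h z = h z)"
    and "square_integrable f \<and> square_integrable f \<and> (AE z in circle_measure. f z = f z)"
  then have hf: "square_integrable h" "square_integrable f" by auto
  from ae have "AE z in circle_measure. (f z = \<phi> z * h z) = (f z = \<psi> z * h z)"
    by eventually_elim simp
  then have "(AE z in circle_measure. f z = \<phi> z * h z) \<longleftrightarrow> (AE z in circle_measure. f z = \<psi> z * h z)"
    by (rule eventually_cong) simp
  then show "(AE z in circle_measure. f z = \<phi> z * h z) \<longleftrightarrow>
      square_integrable f \<and> square_integrable (if unimodular \<psi> then \<lambda>z. \<psi> z * h z else h) \<and>
      (AE z in circle_measure. f z = (if unimodular \<psi> then \<lambda>z. \<psi> z * h z else h) z)"
    using hf \<psi> by (simp add: square_integrable_unimodular_mult)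
qed

section \<open>Closure properties of Hardy space and of orthogonal complements\<close>

lemma H2_diff: "f \<in> H2 \<Longrightarrow> g \<in> H2 \<Longrightarrow> f - g \<in> H2"
  and H2_add: "f \<in> H2 \<Longrightarrow> g \<in> H2 \<Longrightarrow> f + g \<in> H2"
  and H2_scaleC: "f \<in> H2 \<Longrightarrow> c *\<^sub>C f \<in> H2"
  by (simp_all add: H2_def fourier_coeff_diff fourier_coeff_add fourier_coeff_scaleC)

lemma shift_in_H2: "f \<in> H2 \<Longrightarrow> shift f \<in> H2"
  by (simp add: H2_def fourier_coeff_shift)

lemma backward_shift_in_H2: "f \<in> H2 \<Longrightarrow> backward_shift f \<in> H2"
  by (simp add: H2_def fourier_coeff_backward_shift)

lemma diff_in_orth_compl: "x \<in> orth_compl V \<Longrightarrow> y \<in> orth_compl V \<Longrightarrow> x - y \<in> orth_compl V"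
  and add_in_orth_compl: "x \<in> orth_compl V \<Longrightarrow> y \<in> orth_compl V \<Longrightarrow> x + y \<in> orth_compl V"
  by (simp_all add: orth_compl_def cinner_diff_left cinner_add_left)

section \<open>The unitary equivalence\<close>

theorem corollary4p4:
  fixes u :: "complex \<Rightarrow> complex"
  assumes "inner_function u" and "u 0 = 0"
  shows "unitarily_equivalent
           (orth_compl (model_space u)) (dual_compressed_shift u)
           (H2 \<times> H2) (map_prod shift backward_shift)"
proof -
  obtain \<psi> where \<psi>: "unimodular \<psi>" and lim: "AE z in circle_measure. has_radial_limit u z (\<psi> z)"
    using inner_function_boundary[OF assms(1)] .
  define M where "M = mult_by \<psi>"
  have boundary: "AE z in circle_measure. boundary_value u z = \<psi> z"
    using lim by eventually_elim (rule boundary_value_eqI)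
  define K where "K = model_space u"
  have "{f. \<exists>h\<in>H2. is_mult (boundary_value u) h f} = M ` H2"
    by (auto simp: is_mult_iff_mult_by[OF \<psi> boundary] M_def)
  then have K: "K = H2 \<inter> orth_compl (M ` H2)" by (simp add: K_def model_space_def)
  have M_coeff: "fourier_coeff (M h) n = 0" if "h \<in> H2" "n \<le> 0" for h n
    unfolding M_def
  proof (rule fourier_coeff_inner_mult_eq_zero[OF assms(1) \<psi> lim])
    \<comment> \<open>At \<open>j = 0\<close> the Taylor coefficient is u(0) = 0; for
      \<open>j \<ge> 1\<close> the index \<open>n - j\<close> is negative even when
      \<open>n = 0\<close>.\<close>
    show "(deriv ^^ j) u 0 = 0 \<or> fourier_coeff h (n - int j) = 0" for j
      using that assms(2) by (cases "j = 0") (auto simp: H2_def)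
  qed
  then have M_H2: "M h \<in> H2" if "h \<in> H2" for h using that by (simp add: H2_def)
  have M_inner: "cinner (M f) (M g) = cinner f g" for f g
    by (simp add: M_def cinner_mult_by)
  have const_K: "const_L2 c \<in> K" for c
  proof -
    have "cinner (const_L2 c) (M h) = 0" if "h \<in> H2" for h
      using M_coeff[OF that, of 0] by (simp add: const_L2_eq_monomial cinner_scaleC_left cinner_monomial_left)
    then show ?thesis
      by (auto simp: K H2_def orth_compl_def fourier_coeff_const)
  qed
  have MH_perp: "M h \<in> orth_compl K" if "h \<in> H2" for h
    using that by (auto simp: K orth_compl_def cinner_eq_zero_commute[of "M h"])
  have minus_perp: "g \<in> orth_compl K" if "g \<in> H2_minus" for g
    using that cinner_H2_H2_minus by (auto simp: K orth_compl_def cinner_eq_zero_commute[of g])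
  have perp_decomp: "\<exists>h\<in>H2. \<exists>g\<in>H2_minus. x = M h + g" if x: "x \<in> orth_compl K" for x
  proof -
    obtain y g where y: "y \<in> H2" and g: "g \<in> H2_minus" and xyg: "x = y + g"
      by (rule L2_decomposition)
    \<comment> \<open>Dividing by \<psi> reduces the splitting of \<open>y\<close> along \<psi> H^2
      to a splitting by the sign of the frequencies.\<close>
    obtain p q where p: "p \<in> H2" and q: "q \<in> H2_minus"
      and pq: "mult_by (\<lambda>z. cnj (\<psi> z)) y = p + q"
      by (rule L2_decomposition)
    have y_eq: "y = M p + M q"
      using mult_by_mult_by_cnj[OF \<psi>, of y] by (simp add: pq M_def mult_by_add)
    then have "M q = y - M p" by simp
    then have Mq: "M q \<in> H2" using y M_H2[OF p] by (simp add: H2_diff)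
    have Mq_perp: "cinner (M h) (M q) = 0" if "h \<in> H2" for h
      using that q by (simp add: M_inner cinner_H2_H2_minus)
    \<comment> \<open>\<open>M q\<close> is the component of \<open>x\<close> in \<open>K\<close>:
      the other two components \<open>M p\<close> and \<open>g\<close> are orthogonal to it. As
      \<open>x\<close> is orthogonal to \<open>K\<close>, this component vanishes.\<close>
    have "M q \<in> K"
      using Mq Mq_perp by (auto simp: K orth_compl_def cinner_eq_zero_commute[of "M q"])
    then have "cinner x (M q) = 0" using x by (simp add: orth_compl_def)
    moreover have "cinner g (M q) = 0"
      using cinner_H2_H2_minus[OF Mq g] by (simp add: cinner_eq_zero_commute)
    ultimately have "cinner (M q) (M q) = 0"
      using Mq_perp[OF p] by (simp add: xyg y_eq cinner_add_left)
    then have "M q = 0" by (simp add: cinner_eq_zero_iff)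
    then have "x = M p + g" using xyg y_eq by simp
    then show ?thesis using p g by blast
  qed
  define W where "W p = M (fst p) + reflect (snd p)" for p
  have W_perp: "W p \<in> orth_compl K" if "p \<in> H2 \<times> H2" for p
    using that unfolding W_def
    by (intro add_in_orth_compl MH_perp minus_perp) (auto simp: reflect_in_H2_minus_iff)
  have "unitary_map (H2 \<times> H2) (orth_compl K) W"
    unfolding unitary_map_def
  proof (intro conjI ballI allI)
    show "W (x + y) = W x + W y" for x y
      by (simp add: W_def M_def mult_by_add reflect_add algebra_simps)
    show "W (c *\<^sub>C x) = c *\<^sub>C W x" for c x
      by (simp add: W_def M_def scaleC_prod_def mult_by_scaleC reflect_scaleC scaleC_add_right)
    show "cinner (W x) (W y) = cinner x y" if "x \<in> H2 \<times> H2" "y \<in> H2 \<times> H2" for x y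
    proof -
      have "cinner (M h) (reflect k) = 0" "cinner (reflect k) (M h) = 0" if "h \<in> H2" "k \<in> H2" for h k
        using cinner_H2_H2_minus[OF M_H2[OF that(1)]] that(2)
        by (simp_all add: reflect_in_H2_minus_iff cinner_eq_zero_commute[of "reflect k"])
      then show ?thesis
        using that by (auto simp: W_def cinner_prod_def cinner_add_left cinner_add_right M_inner cinner_reflect)
    qed
    show "W ` (H2 \<times> H2) = orth_compl K"
    proof
      show "W ` (H2 \<times> H2) \<subseteq> orth_compl K" using W_perp by blast
      show "orth_compl K \<subseteq> W ` (H2 \<times> H2)"
      proof
        fix x assume "x \<in> orth_compl K"
        then obtain h g where h: "h \<in> H2" and g: "g \<in> H2_minus" and x: "x = M h + g"
          using perp_decomp by blast
        have "reflect g \<in> H2"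
          using g reflect_in_H2_minus_iff[of "reflect g"] by (simp add: reflect_reflect)
        moreover have "x = W (h, reflect g)" by (simp add: x W_def reflect_reflect)
        ultimately show "x \<in> W ` (H2 \<times> H2)" using h by blast
      qed
    qed
  qed
  moreover have "W (map_prod shift backward_shift p) = dual_compressed_shift u (W p)" if "p \<in> H2 \<times> H2" for p
  proof -
    obtain h k where p: "p = (h, k)" and h: "h \<in> H2" and k: "k \<in> H2" using \<open>p \<in> H2 \<times> H2\<close> by auto
    let ?c = "const_L2 (fourier_coeff k 0)"
    have "mult_z (f + g) = mult_z f + mult_z g" for f g
      by (simp add: mult_z_eq_mult_by mult_by_add)
    then have W_eq: "W (map_prod shift backward_shift p) = mult_z (W p) - ?c"
      by (simp add: p W_def M_def shift_def mult_by_mult_z reflect_backward_shift)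
    \<comment> \<open>The constant lies in \<open>K\<close>, and by \<open>W_eq\<close> what remains
      of \<open>mult_z (W p)\<close> is a value of \<open>W\<close> on the pair of Hardy spaces,
      hence orthogonal to \<open>K\<close>.\<close>
    have "orth_proj K (mult_z (W p)) = ?c"
    proof (rule orth_proj_eqI[OF const_K])
      have "map_prod shift backward_shift p \<in> H2 \<times> H2"
        using h k by (simp add: p shift_in_H2 backward_shift_in_H2)
      then show "mult_z (W p) - ?c \<in> orth_compl K"
        using W_perp W_eq by metis
      show "a - b \<in> K" if "a \<in> K" "b \<in> K" for a b
        using that by (auto simp: K intro: H2_diff diff_in_orth_compl)
    qed
    then show ?thesis by (simp add: W_eq dual_compressed_shift_def flip: K_def)
  qed
  ultimately have "unitarily_equivalent (H2 \<times> H2) (map_prod shift backward_shift) (orth_compl K) (dual_compressed_shift u)"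
    unfolding unitarily_equivalent_def by blast
  then show ?thesis
    unfolding K_def[symmetric]
    by (rule unitarily_equivalent_sym)
       (auto simp: shift_in_H2 backward_shift_in_H2 H2_add H2_scaleC scaleC_prod_def)
qed

end
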